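(* Let $N\geq 1$ and $d\geq 2$, and let $k$ be an algebraically closed field of characteristic $0$ or of characteristic $p>d$. Then the locus of post-critically finite maps in $\mathcal{P}_{N,d}(k)$ is a countable union of $0$-dimensional subvarieties.
   Context: A morphism $f:\mathbb{P}^N\to\mathbb{P}^N$ of degree $d$ is called a monic polynomial if there is a hyperplane $H\subseteq\mathbb{P}^N$ which is totally invariant under $f$ and such that the restriction of $f$ to $H\cong\mathbb{P}^{N-1}$ is the $d$th power map $[x_0:\cdots:x_{N-1}]\mapsto[x_0^d:\cdots:x_{N-1}^d]$ in some coordinates. Equivalently, in suitable homogeneous coordinates $f=[f_0:\cdots:f_N]$ with $f_N=x_N^d$ and $f_i=x_i^d+x_Ng_i(x_0,\dots,x_N)$ for $0\le i<N$, with $g_i$ homogeneous of degree $d-1$. Let $\mathcal{M}_{N,d}$ denote the moduli space of degree-$d$ endomorphisms of $\mathbb{P}^N$, i.e. the space of such morphisms (parametrized by their coefficients) modulo conjugation by $\mathrm{PGL}_{N+1}$; $\mathcal{P}_{N,d}\subseteq\mathcal{M}_{N,d}$ is the subvariety consisting of conjugacy classes of monic polynomials. A morphism $f$ is post-critically finite (PCF) if the forward orbit of its ramification (critical) locus under $f$ is supported on a finite union of hypersurfaces, i.e. the sequence of (reduced) images $f^n(R_f)$, $n\ge 0$, of the ramification divisor $R_f$ takes only finitely many values. *)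

theory Defs
  imports "HOL-Library.Countable_Set" "HOL-Combinatorics.Permutations" "HOL-Computational_Algebra.Polynomial"
begin

definition alg_closed :: "'k::field itself \<Rightarrow> bool" where
  "alg_closed _ \<longleftrightarrow> (\<forall>p :: 'k poly. degree p \<ge> 1 \<longrightarrow> (\<exists>x. poly p x = 0))"

text \<open>Polynomials in the variables x_0,...,x_N are coefficient functions on exponent
  vectors (m i = exponent of x_i).  Homogeneous forms of degree e are those whose
  coefficients vanish outside the (finite) set of monomials of degree e in x_0..x_N.\<close>
type_synonym 'k mpoly = "(nat \<Rightarrow> nat) \<Rightarrow> 'k"

definition mons_deg :: "nat \<Rightarrow> nat \<Rightarrow> (nat \<Rightarrow> nat) set" where
  "mons_deg N e = {m. (\<forall>i. N < i \<longrightarrow> m i = 0) \<and> (\<Sum>i\<le>N. m i) = e}"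

definition homogeneous :: "nat \<Rightarrow> nat \<Rightarrow> 'k::zero mpoly \<Rightarrow> bool" where
  "homogeneous N e c \<longleftrightarrow> (\<forall>m. c m \<noteq> 0 \<longrightarrow> m \<in> mons_deg N e)"

definition eval_form :: "nat \<Rightarrow> nat \<Rightarrow> 'k::comm_ring_1 mpoly \<Rightarrow> (nat \<Rightarrow> 'k) \<Rightarrow> 'k" where
  "eval_form N e c x = (\<Sum>m\<in>mons_deg N e. c m * (\<Prod>i\<le>N. x i ^ m i))"

definition pderiv_form :: "nat \<Rightarrow> 'k::comm_ring_1 mpoly \<Rightarrow> 'k mpoly" where
  "pderiv_form j c = (\<lambda>m. of_nat (m j + 1) * c (m(j := m j + 1)))"

definition mono_pow :: "nat \<Rightarrow> nat \<Rightarrow> nat \<Rightarrow> nat" where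
  "mono_pow i e = (\<lambda>j. if j = i then e else 0)"

text \<open>Vectors in k^(N+1) (coordinates 0..N) and points of P^N (nonzero vectors).\<close>
definition vecs :: "nat \<Rightarrow> (nat \<Rightarrow> 'k::zero) set" where
  "vecs N = {x. \<forall>i. N < i \<longrightarrow> x i = 0}"

definition pts :: "nat \<Rightarrow> (nat \<Rightarrow> 'k::zero) set" where
  "pts N = {x \<in> vecs N. x \<noteq> (\<lambda>_. 0)}"

definition detn :: "nat \<Rightarrow> (nat \<Rightarrow> nat \<Rightarrow> 'k::comm_ring_1) \<Rightarrow> 'k" where
  "detn n A = (\<Sum>p | p permutes {..<n}. of_int (sign p) * (\<Prod>i<n. A i (p i)))"

definition mat_vec :: "nat \<Rightarrow> (nat \<Rightarrow> nat \<Rightarrow> 'k::comm_ring_1) \<Rightarrow> (nat \<Rightarrow> 'k) \<Rightarrow> nat \<Rightarrow> 'k" where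
  "mat_vec N A x = (\<lambda>i. if i \<le> N then (\<Sum>j\<le>N. A i j * x j) else 0)"

definition eval_map :: "nat \<Rightarrow> nat \<Rightarrow> (nat \<Rightarrow> 'k::comm_ring_1 mpoly) \<Rightarrow> (nat \<Rightarrow> 'k) \<Rightarrow> nat \<Rightarrow> 'k" where
  "eval_map N d f x = (\<lambda>i. if i \<le> N then eval_form N d (f i) x else 0)"

text \<open>Monic polynomial in normal coordinates: f_N = x_N^d and
  f_i = x_i^d + x_N g_i (i < N) with all f_i homogeneous of degree d.\<close>
definition monic_poly :: "nat \<Rightarrow> nat \<Rightarrow> (nat \<Rightarrow> 'k::comm_ring_1 mpoly) \<Rightarrow> bool" where
  "monic_poly N d f \<longleftrightarrow>
     (\<forall>i\<le>N. homogeneous N d (f i)) \<and>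
     (\<forall>m. f N m = (if m = mono_pow N d then 1 else 0)) \<and>
     (\<forall>i<N. \<forall>m. m N = 0 \<longrightarrow> f i m = (if m = mono_pow i d then 1 else 0))"

definition ram_locus :: "nat \<Rightarrow> nat \<Rightarrow> (nat \<Rightarrow> 'k::comm_ring_1 mpoly) \<Rightarrow> (nat \<Rightarrow> 'k) set" where
  "ram_locus N d f =
     {x \<in> pts N. detn (Suc N) (\<lambda>i j. eval_form N (d - 1) (pderiv_form j (f i)) x) = 0}"

text \<open>Image of a (cone of) points under f, as a scaling-invariant set of nonzero vectors.\<close>
definition map_image :: "nat \<Rightarrow> nat \<Rightarrow> (nat \<Rightarrow> 'k::comm_ring_1 mpoly) \<Rightarrow> (nat \<Rightarrow> 'k) set \<Rightarrow> (nat \<Rightarrow> 'k) set" where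
  "map_image N d f S = {(\<lambda>i. c * eval_map N d f x i) | c x. c \<noteq> 0 \<and> x \<in> S}"

definition pcf :: "nat \<Rightarrow> nat \<Rightarrow> (nat \<Rightarrow> 'k::comm_ring_1 mpoly) \<Rightarrow> bool" where
  "pcf N d f \<longleftrightarrow> finite (range (\<lambda>n. (map_image N d f ^^ n) (ram_locus N d f)))"

definition conjugate :: "nat \<Rightarrow> nat \<Rightarrow> (nat \<Rightarrow> 'k::field mpoly) \<Rightarrow> (nat \<Rightarrow> 'k mpoly) \<Rightarrow> bool" where
  "conjugate N d f g \<longleftrightarrow>
     (\<exists>A lam. detn (Suc N) A \<noteq> 0 \<and> lam \<noteq> 0 \<and>
        (\<forall>x\<in>vecs N. mat_vec N A (eval_map N d g x) = (\<lambda>i. lam * eval_map N d f (mat_vec N A x) i)))"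

end

theory Submission
  imports Defs "Jordan_Normal_Form.Determinant"
begin

text \<open>
  After a translation the coefficient of x_i^(d-1) x_N in f_i vanishes for every i < N. It is
  then enough to show that all coefficients of a PCF map are algebraic over the prime field.
  Otherwise Chevalley's theorem gives a valuation ring V, containing the prime field, that misses
  some coefficient. Let r be the maximum of |c|^(1/m_N) over the coefficients c of monomials m in
  the f_a, a < N, attained in f_i, and write r = |q|^d. Give x_N size 1, the x_j (j \<noteq> i) size
  |q|^(d+1), and x_i the largest size t for which a lower term of f_i can match x_i^d; then
  |q|^d \<le> t \<le> |q|^(d+1). At these sizes S the map reduces to the power map in every row but the
  i-th, and at the sizes S^(d^k), k \<ge> 1, it reduces to the power map in all rows. In the i-th row
  it reduces to a one-variable polynomial which is not of the form (X - c)^d, hence has a critical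
  point that is not a root; it lifts to a point x of the ramification locus with f(x) exactly of
  sizes S^d. Consequently f^n of the ramification locus meets the points of sizes exactly S^(d^n),
  but not those of sizes S^(d^m) with m > n: such a point would come from a point of sizes
  S^(d^(m-n)) in the ramification locus, and there the Jacobian does not vanish because the
  reduction is the power map. So the images are pairwise distinct.
\<close>

hide_const (open) Module.smult conjugate_class.conjugate

section \<open>Valuation rings\<close>

text \<open>A countable union of 0-dimensional subvarieties is a countable set of classes, and only
  countably many elements of k are algebraic over the prime field. Since k is arbitrary, the
  valuation may have any ordered value group; sizes are compared by divisibility, and roots of sizes
  are roots of elements of k. The obstacle is that one escaping critical point does not keep the
  images, which are whole hypersurfaces, from repeating; sets of exact sizes with known preimages
  supply an invariant that tells them apart. Enlarging all coordinates but x_i and x_N leaves one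
  nontrivial row: modulo the maximal ideal the Jacobian is a unit times a derivative in one
  variable, whereas equal sizes would leave a whole system. The translation excludes (X - c)^d,
  whose coefficient of X^(d-1) is -dc: it forces c = 0, against the lower term that ties with X^d.
  The bound on the characteristic makes 1, ..., d units of V: d for the derivative of the power map
  and for the translation, the rest as multiplicities of roots.\<close>

locale valuation_ring =
  fixes V :: "'k::field set"
  assumes one_mem: "1 \<in> V"
    and add_mem: "x \<in> V \<Longrightarrow> y \<in> V \<Longrightarrow> x + y \<in> V"
    and minus_mem: "x \<in> V \<Longrightarrow> - x \<in> V"
    and mult_mem: "x \<in> V \<Longrightarrow> y \<in> V \<Longrightarrow> x * y \<in> V"
    and total_mem: "x \<in> V \<or> inverse x \<in> V"
begin

text \<open>Stands for |a| \<le> |b|. The value group is never formed: an element of the field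
  serves as a name for its size.\<close>

definition vle :: "'k \<Rightarrow> 'k \<Rightarrow> bool" (infix "\<preceq>" 50) where
  "a \<preceq> b \<longleftrightarrow> (\<exists>c\<in>V. a = c * b)"

definition vlt :: "'k \<Rightarrow> 'k \<Rightarrow> bool" (infix "\<prec>" 50) where
  "a \<prec> b \<longleftrightarrow> \<not> b \<preceq> a"

definition vunit :: "'k \<Rightarrow> bool" where
  "vunit a \<longleftrightarrow> a \<in> V \<and> a \<noteq> 0 \<and> inverse a \<in> V"

definition mideal :: "'k set" where
  "mideal = {a \<in> V. \<not> vunit a}"

lemma zero_mem: "0 \<in> V"
  using add_mem[OF one_mem minus_mem[OF one_mem]] by simp

lemma diff_mem: "x \<in> V \<Longrightarrow> y \<in> V \<Longrightarrow> x - y \<in> V"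
  using add_mem[of x "- y"] minus_mem by simp

lemma sum_mem: "(\<And>x. x \<in> A \<Longrightarrow> g x \<in> V) \<Longrightarrow> sum g A \<in> V"
  by (induction A rule: infinite_finite_induct) (auto intro: add_mem zero_mem)

lemma prod_mem: "(\<And>x. x \<in> A \<Longrightarrow> g x \<in> V) \<Longrightarrow> prod g A \<in> V"
  by (induction A rule: infinite_finite_induct) (auto intro: mult_mem one_mem)

lemma power_mem: "x \<in> V \<Longrightarrow> x ^ n \<in> V"
  by (induction n) (auto intro: mult_mem one_mem)

lemma of_nat_mem: "of_nat n \<in> V"
  by (induction n) (auto intro: add_mem zero_mem one_mem)

lemma of_int_mem: "of_int n \<in> V"
  by (cases n) (auto simp flip: of_nat_Suc intro!: minus_mem of_nat_mem)

lemma vle_refl: "a \<preceq> a"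
  unfolding vle_def using one_mem by force

lemma vle_trans [trans]: "a \<preceq> b \<Longrightarrow> b \<preceq> c \<Longrightarrow> a \<preceq> c"
  unfolding vle_def by (metis mult.assoc mult_mem)

lemma vle_total: "a \<preceq> b \<or> b \<preceq> a"
proof (cases "a = 0 \<or> b = 0")
  case True
  then show ?thesis unfolding vle_def using zero_mem by force
next
  case False
  have "a = (a / b) * b" "b = inverse (a / b) * a" using False by auto
  then show ?thesis unfolding vle_def using total_mem[of "a / b"] by metis
qed

lemma vlt_imp_vle: "a \<prec> b \<Longrightarrow> a \<preceq> b"
  using vle_total vlt_def by blast

lemma vle_vlt_trans [trans]: "a \<preceq> b \<Longrightarrow> b \<prec> c \<Longrightarrow> a \<prec> c"
  unfolding vlt_def using vle_trans[of c a b] by blast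

lemma vlt_vle_trans [trans]: "a \<prec> b \<Longrightarrow> b \<preceq> c \<Longrightarrow> a \<prec> c"
  unfolding vlt_def using vle_trans[of b c a] by blast

lemma zero_vle: "0 \<preceq> a"
  unfolding vle_def using zero_mem by force

lemma vlt_nonzero: "a \<prec> b \<Longrightarrow> b \<noteq> 0"
  unfolding vlt_def using zero_vle by blast

lemma zero_vlt: "b \<noteq> 0 \<Longrightarrow> 0 \<prec> b"
  unfolding vlt_def vle_def by simp

lemma vle_mult: "a \<preceq> b \<Longrightarrow> c \<preceq> e \<Longrightarrow> a * c \<preceq> b * e"
  unfolding vle_def
proof clarify
  fix x y assume "x \<in> V" "y \<in> V"
  then show "\<exists>z\<in>V. x * b * (y * e) = z * (b * e)"
    by (intro bexI[of _ "x * y"]) (auto intro: mult_mem simp: algebra_simps)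
qed

lemma vle_cancel: "c \<noteq> 0 \<Longrightarrow> a * c \<preceq> b * c \<longleftrightarrow> a \<preceq> b"
  unfolding vle_def by (simp flip: mult.assoc)

lemma vlt_cancel: "c \<noteq> 0 \<Longrightarrow> a * c \<prec> b * c \<longleftrightarrow> a \<prec> b"
  unfolding vlt_def using vle_cancel by simp

lemma vle_vlt_mult: "a \<preceq> b \<Longrightarrow> c \<prec> e \<Longrightarrow> b \<noteq> 0 \<Longrightarrow> a * c \<prec> b * e"
proof -
  assume a: "a \<preceq> b" "c \<prec> e" "b \<noteq> 0"
  have "a * c \<preceq> b * c" using vle_mult[OF a(1) vle_refl] .
  moreover have "b * c \<prec> b * e" using vlt_cancel[of b c e] a by (simp add: mult.commute)
  ultimately show ?thesis by (rule vle_vlt_trans)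
qed

lemma vlt_vle_mult: "a \<prec> b \<Longrightarrow> c \<preceq> e \<Longrightarrow> e \<noteq> 0 \<Longrightarrow> a * c \<prec> b * e"
  using vle_vlt_mult[of c e a b] by (simp add: mult.commute)

lemma vle_power: "a \<preceq> b \<Longrightarrow> a ^ n \<preceq> b ^ n"
  by (induction n) (auto intro: vle_mult vle_refl)

lemma vlt_power: "a \<prec> b \<Longrightarrow> n > 0 \<Longrightarrow> a ^ n \<prec> b ^ n"
proof (induction n)
  case (Suc n)
  have "b ^ n \<noteq> 0" using vlt_nonzero[OF Suc.prems(1)] by simp
  then show ?case
    using vlt_vle_mult[OF Suc.prems(1) vle_power[OF vlt_imp_vle[OF Suc.prems(1)], of n]] by simp
qed simp

lemma vle_power_iff: "n > 0 \<Longrightarrow> a ^ n \<preceq> b ^ n \<longleftrightarrow> a \<preceq> b"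
  using vle_power[of a b n] vlt_power[of b a n] unfolding vlt_def by argo

lemma vle_power_mono: "1 \<preceq> a \<Longrightarrow> m \<le> n \<Longrightarrow> a ^ m \<preceq> a ^ n"
  using vle_mult[OF vle_refl[of "a ^ m"] vle_power[of 1 a "n - m"]]
  by (simp flip: power_add)

lemma vlt_power_mono: "1 \<prec> a \<Longrightarrow> m < n \<Longrightarrow> a ^ m \<prec> a ^ n"
  using vle_vlt_mult[OF vle_refl[of "a ^ m"] vlt_power[of 1 a "n - m"]] vlt_nonzero[of 1 a]
  by (simp flip: power_add)

lemma vle_one_iff: "a \<preceq> 1 \<longleftrightarrow> a \<in> V"
  unfolding vle_def by simp

lemma vle_divide_iff: "b \<noteq> 0 \<Longrightarrow> a / b \<in> V \<longleftrightarrow> a \<preceq> b"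
  using vle_cancel[of b "a / b" 1] by (simp add: vle_one_iff)

lemma vunit_iff: "vunit a \<longleftrightarrow> a \<in> V \<and> 1 \<preceq> a"
proof -
  have "1 \<preceq> a \<longleftrightarrow> a \<noteq> 0 \<and> inverse a \<in> V"
  proof
    assume "1 \<preceq> a"
    then obtain c where "c \<in> V" "c * a = 1" unfolding vle_def by metis
    then show "a \<noteq> 0 \<and> inverse a \<in> V"
      using inverse_unique[of a c] by (auto simp: mult.commute)
  next
    assume "a \<noteq> 0 \<and> inverse a \<in> V"
    then show "1 \<preceq> a" unfolding vle_def by (intro bexI[of _ "inverse a"]) auto
  qed
  then show ?thesis by (auto simp: vunit_def)
qed

lemma mideal_iff: "a \<in> mideal \<longleftrightarrow> a \<prec> 1"
  unfolding mideal_def using vunit_iff vle_one_iff[of a] vlt_def[of a 1] vlt_imp_vle[of a 1] by auto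

lemma mideal_divide_iff: "b \<noteq> 0 \<Longrightarrow> a / b \<in> mideal \<longleftrightarrow> a \<prec> b"
  using vlt_cancel[of b "a / b" 1] by (simp add: mideal_iff)

lemma mideal_mem: "a \<in> mideal \<Longrightarrow> a \<in> V"
  by (simp add: mideal_def)

lemma vunit_mem: "a \<in> V \<Longrightarrow> a \<notin> mideal \<Longrightarrow> vunit a"
  by (simp add: mideal_def)

lemma zero_mideal: "0 \<in> mideal"
  by (simp add: mideal_def zero_mem vunit_def)

lemma one_vunit: "vunit 1"
  by (simp add: vunit_def one_mem)

lemma vunit_mult: "vunit a \<Longrightarrow> vunit b \<Longrightarrow> vunit (a * b)"
  by (simp add: vunit_def mult_mem)

lemma vunit_divide: "vunit a \<Longrightarrow> vunit b \<Longrightarrow> vunit (a / b)"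
  by (simp add: vunit_def mult_mem divide_inverse)

lemma vunit_power: "vunit a \<Longrightarrow> vunit (a ^ n)"
  by (induction n) (auto intro: vunit_mult one_vunit)

lemma vunit_prod: "(\<And>x. x \<in> A \<Longrightarrow> vunit (g x)) \<Longrightarrow> vunit (prod g A)"
  by (induction A rule: infinite_finite_induct) (auto intro: vunit_mult one_vunit)

lemma mideal_mult: "a \<in> mideal \<Longrightarrow> b \<in> V \<Longrightarrow> a * b \<in> mideal"
  using vle_vlt_mult[of b 1 a 1] by (simp add: mideal_iff vle_one_iff mult.commute)

lemma mideal_mult': "a \<in> V \<Longrightarrow> b \<in> mideal \<Longrightarrow> a * b \<in> mideal"
  using mideal_mult by (metis mult.commute)

lemma vunit_mult_mideal: "vunit a \<Longrightarrow> a * b \<in> mideal \<Longrightarrow> b \<in> mideal"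
  using mideal_mult'[of "inverse a" "a * b"] by (simp add: vunit_def flip: mult.assoc)

lemma vunit_not_mideal: "vunit a \<Longrightarrow> a \<notin> mideal"
  by (simp add: mideal_def)

lemma mideal_add: "a \<in> mideal \<Longrightarrow> b \<in> mideal \<Longrightarrow> a + b \<in> mideal"
proof -
  assume ab: "a \<in> mideal" "b \<in> mideal"
  have *: "x + y \<in> mideal" if "x \<in> mideal" "y \<in> mideal" "x \<preceq> y" for x y
  proof -
    obtain c where c: "c \<in> V" "x = c * y" using \<open>x \<preceq> y\<close> vle_def by auto
    then have "x + y = (c + 1) * y" by (simp add: algebra_simps)
    then show ?thesis using mideal_mult' that(2) c(1) add_mem one_mem by simp
  qed
  show ?thesis using *[OF ab] *[OF ab(2,1)] vle_total[of a b] by (auto simp: add.commute)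
qed

lemma mideal_minus: "a \<in> mideal \<Longrightarrow> - a \<in> mideal"
  using mideal_mult'[of "- 1" a] minus_mem[OF one_mem] by simp

lemma mideal_diff: "a \<in> mideal \<Longrightarrow> b \<in> mideal \<Longrightarrow> a - b \<in> mideal"
  using mideal_add[of a "- b"] mideal_minus by simp

lemma mideal_sum: "(\<And>x. x \<in> A \<Longrightarrow> g x \<in> mideal) \<Longrightarrow> sum g A \<in> mideal"
  by (induction A rule: infinite_finite_induct) (auto intro: mideal_add zero_mideal)

lemma mideal_prod:
  assumes "finite A" "\<And>x. x \<in> A \<Longrightarrow> g x \<in> V" "y \<in> A" "g y \<in> mideal"
  shows "prod g A \<in> mideal"
  using assms by (auto simp: prod.remove[of A y] intro!: mideal_mult prod_mem)

lemma mideal_power: "a \<in> mideal \<Longrightarrow> n > 0 \<Longrightarrow> a ^ n \<in> mideal"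
  by (cases n) (simp_all add: mideal_mult power_mem mideal_mem)

lemma vunit_cong: "vunit a \<Longrightarrow> a - b \<in> mideal \<Longrightarrow> vunit b"
proof -
  assume a: "vunit a" "a - b \<in> mideal"
  have "a \<in> V" using a(1) by (simp add: vunit_def)
  then have "b \<in> V" using diff_mem[of a "a - b"] mideal_mem[OF a(2)] by simp
  moreover have "b \<notin> mideal" using mideal_add[OF a(2), of b] vunit_not_mideal[OF a(1)] by auto
  ultimately show "vunit b" by (rule vunit_mem)
qed

lemma cong_sym: "a - b \<in> mideal \<Longrightarrow> b - a \<in> mideal"
  using mideal_minus[of "a - b"] by simp

lemma cong_trans: "a - b \<in> mideal \<Longrightarrow> b - c \<in> mideal \<Longrightarrow> a - c \<in> mideal"
  using mideal_add[of "a - b" "b - c"] by simp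

lemma cong_mult:
  assumes "a - b \<in> mideal" "c - e \<in> mideal" "a \<in> V" "e \<in> V"
  shows "a * c - b * e \<in> mideal"
proof -
  have "a * c - b * e = a * (c - e) + (a - b) * e" by (simp add: algebra_simps)
  then show ?thesis using assms by (simp add: mideal_add mideal_mult mideal_mult')
qed

lemma vle_add: "a \<preceq> c \<Longrightarrow> b \<preceq> c \<Longrightarrow> a + b \<preceq> c"
  unfolding vle_def by (metis add_mem distrib_right)

lemma vle_max_exists:
  assumes "finite A" "A \<noteq> {}"
  shows "\<exists>a\<in>A. \<forall>b\<in>A. g b \<preceq> g a"
  using assms
proof (induction rule: finite_ne_induct)
  case (singleton x)
  then show ?case using vle_refl by simp
next
  case (insert x F)
  then obtain a where a: "a \<in> F" "\<forall>b\<in>F. g b \<preceq> g a" by blast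
  show ?case
  proof (cases "g x \<preceq> g a")
    case True
    then show ?thesis using a by blast
  next
    case False
    then have ax: "g a \<preceq> g x" using vle_total by blast
    have "g b \<preceq> g x" if "b \<in> insert x F" for b
      using that vle_refl a(2) vle_trans[OF _ ax] by auto
    then show ?thesis by blast
  qed
qed

end

section \<open>Polynomials over a valuation ring\<close>

lemma alg_closed_root:
  fixes p :: "'k::field poly"
  assumes "alg_closed TYPE('k)" "degree p \<ge> 1"
  shows "\<exists>x. poly p x = 0"
  using assms unfolding alg_closed_def by blast

lemma alg_closed_nth_root:
  fixes a :: "'k::field"
  assumes "alg_closed TYPE('k)" "n > 0"
  shows "\<exists>x. x ^ n = a"
proof -
  have "degree (monom 1 n + [:- a:]) = n"
    using assms(2) by (subst degree_add_eq_left) (auto simp: degree_monom_eq)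
  then obtain x where "poly (monom 1 n + [:- a:]) x = 0"
    using alg_closed_root[OF assms(1)] assms(2) by (metis One_nat_def Suc_leI)
  then show ?thesis by (auto simp: poly_monom)
qed

lemma alg_closed_split:
  fixes p :: "'k::field poly"
  assumes "alg_closed TYPE('k)" "p \<noteq> 0"
  shows "\<exists>rs. p = smult (lead_coeff p) (\<Prod>r\<leftarrow>rs. [:- r, 1:]) \<and> length rs = degree p"
  using assms(2)
proof (induction "degree p" arbitrary: p)
  case 0
  then obtain c where "p = [:c:]" by (metis degree_eq_zeroE)
  then show ?case by (intro exI[of _ "[]"]) auto
next
  case (Suc n)
  then obtain x where "poly p x = 0" using alg_closed_root[OF assms(1), of p] by auto
  then obtain q where q: "p = [:- x, 1:] * q" using poly_eq_0_iff_dvd by blast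
  have "q \<noteq> 0" using q Suc.prems by auto
  then have "degree p = Suc (degree q)" using q degree_mult_eq[of "[:- x, 1:]" q] by simp
  then obtain rs where rs: "q = smult (lead_coeff q) (\<Prod>r\<leftarrow>rs. [:- r, 1:])" "length rs = degree q"
    using Suc.hyps \<open>q \<noteq> 0\<close> by auto
  have lc: "lead_coeff p = lead_coeff q" using q lead_coeff_mult[of "[:- x, 1:]" q] by simp
  have "p = [:- x, 1:] * smult (lead_coeff p) (\<Prod>r\<leftarrow>rs. [:- r, 1:])"
    using q rs(1) unfolding lc by simp
  also have "\<dots> = smult (lead_coeff p) (\<Prod>r\<leftarrow>x # rs. [:- r, 1:])"
    by (simp only: mult_smult_right list.map prod_list.Cons)
  finally show ?case using rs(2) \<open>degree p = Suc (degree q)\<close>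
    by (intro exI[of _ "x # rs"]) simp
qed

lemma prod_list_map_count:
  assumes "finite A" "set xs \<subseteq> A"
  shows "prod_list (map g xs) = (\<Prod>t\<in>A. (g t :: 'b::comm_monoid_mult) ^ count_list xs t)"
  using assms(2)
proof (induction xs)
  case (Cons x xs)
  have "(\<Prod>t\<in>A. g t ^ count_list (x # xs) t)
      = (\<Prod>t\<in>A. (if x = t then g t else 1) * g t ^ count_list xs t)"
    by (intro prod.cong) auto
  also have "\<dots> = g x * (\<Prod>t\<in>A. g t ^ count_list xs t)"
    using Cons.prems assms(1) by (simp add: prod.distrib)
  finally show ?case using Cons by simp
qed simp

lemma coeff_prod_linear:
  assumes "finite A"
  shows "degree (\<Prod>s\<in>A. [:- s, 1:] :: 'k::field poly) = card A"
    "coeff (\<Prod>s\<in>A. [:- s, 1:]) (card A) = (1 :: 'k)"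
proof -
  show d: "degree (\<Prod>s\<in>A. [:- s, 1:] :: 'k poly) = card A"
    by (subst degree_prod_sum_eq) auto
  show "coeff (\<Prod>s\<in>A. [:- s, 1:]) (card A) = (1 :: 'k)"
    using lead_coeff_prod[of "\<lambda>s. [:- s, 1:]" A] unfolding d by simp
qed

context valuation_ring
begin

definition integral_poly :: "'k poly \<Rightarrow> bool" where
  "integral_poly p \<longleftrightarrow> (\<forall>l. coeff p l \<in> V)"

text \<open>Vanishing of the reduction modulo \<open>mideal\<close>. The residue field is never
  formed; identities over it are stated as differences with this property.\<close>

definition residue_zero :: "'k poly \<Rightarrow> bool" where
  "residue_zero p \<longleftrightarrow> (\<forall>l. coeff p l \<in> mideal)"

lemma integral_poly_mult: "integral_poly p \<Longrightarrow> integral_poly q \<Longrightarrow> integral_poly (p * q)"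
  by (auto simp: integral_poly_def coeff_mult intro!: sum_mem mult_mem)

lemma integral_poly_linear: "a \<in> V \<Longrightarrow> integral_poly [:- a, 1:]"
  by (auto simp: integral_poly_def coeff_pCons zero_mem one_mem minus_mem split: nat.split)

lemma integral_poly_one: "integral_poly 1"
  by (auto simp: integral_poly_def coeff_1 zero_mem one_mem)

lemma integral_poly_prod: "(\<And>x. x \<in> A \<Longrightarrow> integral_poly (g x)) \<Longrightarrow> integral_poly (prod g A)"
  by (induction A rule: infinite_finite_induct) (auto intro: integral_poly_mult integral_poly_one)

lemma integral_poly_eval: "integral_poly p \<Longrightarrow> x \<in> V \<Longrightarrow> poly p x \<in> V"
  by (auto simp: integral_poly_def poly_altdef intro!: sum_mem mult_mem power_mem)

lemma integral_poly_pderiv: "integral_poly p \<Longrightarrow> integral_poly (pderiv p)"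
  by (auto simp: integral_poly_def coeff_pderiv simp flip: of_nat_Suc intro!: mult_mem of_nat_mem)

lemma residue_zero_mult: "residue_zero p \<Longrightarrow> integral_poly q \<Longrightarrow> residue_zero (p * q)"
  by (auto simp: integral_poly_def residue_zero_def coeff_mult intro!: mideal_sum mideal_mult)

lemma residue_zero_add: "residue_zero p \<Longrightarrow> residue_zero q \<Longrightarrow> residue_zero (p + q)"
  by (auto simp: residue_zero_def intro!: mideal_add)

lemma residue_zero_eval: "residue_zero p \<Longrightarrow> x \<in> V \<Longrightarrow> poly p x \<in> mideal"
  by (auto simp: residue_zero_def poly_altdef intro!: mideal_sum mideal_mult power_mem)

lemma residue_zero_pderiv: "residue_zero p \<Longrightarrow> residue_zero (pderiv p)"
  by (auto simp: residue_zero_def coeff_pderiv simp flip: of_nat_Suc intro!: mideal_mult' of_nat_mem)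

lemma power_cong:
  assumes "x \<in> V" "y \<in> V" "x - y \<in> mideal"
  shows "x ^ n - y ^ n \<in> mideal"
  by (induction n) (use assms in \<open>simp_all add: zero_mideal cong_mult power_mem\<close>)

lemma poly_cong_arg:
  assumes "integral_poly p" "x \<in> V" "y \<in> V" "x - y \<in> mideal"
  shows "poly p x - poly p y \<in> mideal"
proof -
  have "poly p x - poly p y = (\<Sum>i\<le>degree p. coeff p i * (x ^ i - y ^ i))"
    by (simp add: poly_altdef sum_subtractf right_diff_distrib)
  then show ?thesis using assms
    by (auto simp: integral_poly_def intro!: mideal_sum mideal_mult' power_cong)
qed

text \<open>A valuation ring is integrally closed: were 1 \<prec> \<open>w\<close>, the leading term
  would be strictly larger than every other term of \<open>p\<close> at \<open>w\<close>, so the sum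
  could not vanish.\<close>

lemma integral_mem:
  assumes "integral_poly p" "vunit (lead_coeff p)" "poly p w = 0"
  shows "w \<in> V"
proof (rule ccontr)
  assume "w \<notin> V"
  then have w: "1 \<prec> w" unfolding vlt_def vle_one_iff .
  let ?n = "degree p"
  have "w \<noteq> 0" using vlt_nonzero[OF w] .
  have "coeff p l * w ^ l / w ^ ?n \<in> mideal" if "l < ?n" for l
  proof -
    have "coeff p l * w ^ l \<preceq> 1 * w ^ l"
      using assms(1) by (intro vle_mult vle_refl) (simp add: vle_one_iff integral_poly_def)
    also have "1 * w ^ l \<prec> w ^ ?n" using vlt_power_mono[OF w that] by simp
    finally show ?thesis using \<open>w \<noteq> 0\<close> by (simp add: mideal_divide_iff)
  qed
  then have "(\<Sum>l<?n. coeff p l * w ^ l / w ^ ?n) \<in> mideal" by (intro mideal_sum) auto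
  moreover have "poly p w / w ^ ?n = (\<Sum>l<?n. coeff p l * w ^ l / w ^ ?n) + lead_coeff p"
    using \<open>w \<noteq> 0\<close> by (simp add: poly_altdef add_divide_distrib sum_divide_distrib
      flip: lessThan_Suc_atMost)
  ultimately have "- lead_coeff p \<in> mideal"
    using assms(3) by (simp add: eq_neg_iff_add_eq_0[symmetric])
  then show False using mideal_minus[of "- lead_coeff p"] vunit_not_mideal[OF assms(2)] by simp
qed

text \<open>The roots of w g(w) = 1 are units, which provides residues avoiding the zeros of g.\<close>

lemma unit_value:
  assumes "alg_closed TYPE('k)" "integral_poly g" "vunit (coeff g n0)"
  shows "\<exists>w. vunit w \<and> vunit (poly g w)"
proof -
  have n0: "n0 \<le> degree g"
    using assms(3) by (intro le_degree) (auto simp: vunit_def)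
  \<comment> \<open>\<open>Max U\<close> is the degree of the reduction of \<open>g\<close>. Cutting
    \<open>g\<close> off there gives \<open>h\<close>, which is X times the cutoff minus 1, a unit
    as leading coefficient, so its root lies in \<open>V\<close>; the discarded coefficients lie in
    \<open>mideal\<close>.\<close>
  define U where "U = {l. l \<le> degree g \<and> vunit (coeff g l)}"
  have U: "finite U" "n0 \<in> U" using n0 assms(3) by (auto simp: U_def)
  define n where "n = Max U"
  have n: "n \<in> U" using U Max_in unfolding n_def by blast
  define h where "h = pCons (- 1) (poly_cutoff (Suc n) g)"
  have ch: "coeff h l = (case l of 0 \<Rightarrow> - 1 | Suc k \<Rightarrow> if k \<le> n then coeff g k else 0)" for l
    by (auto simp: h_def coeff_pCons coeff_poly_cutoff split: nat.split)
  have "coeff h (Suc n) \<noteq> 0" using n by (auto simp: ch U_def vunit_def)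
  then have dh: "degree h = Suc n"
    by (intro antisym degree_le le_degree) (auto simp: ch split: nat.split)
  then obtain w where w: "poly h w = 0" using alg_closed_root[OF assms(1), of h] by auto
  have "integral_poly h" using assms(2)
    by (auto simp: integral_poly_def ch zero_mem one_mem minus_mem split: nat.split)
  moreover have "vunit (lead_coeff h)" using n unfolding dh by (auto simp: ch U_def)
  ultimately have "w \<in> V" using w by (rule integral_mem)
  define v where "v = poly (poly_cutoff (Suc n) g) w"
  have v: "v \<in> V" unfolding v_def using assms(2) \<open>w \<in> V\<close>
    by (intro integral_poly_eval) (auto simp: integral_poly_def coeff_poly_cutoff zero_mem)
  have wv: "w * v = 1" using w by (simp add: h_def v_def)
  have "inverse w = v" "inverse v = w" "w \<noteq> 0" "v \<noteq> 0"
    using wv inverse_unique[of w v] inverse_unique[of v w] by (auto simp: mult.commute)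
  then have units: "vunit w" "vunit v" using v \<open>w \<in> V\<close> by (auto simp: vunit_def)
  have "residue_zero (poly_cutoff (Suc n) g - g)"
    unfolding residue_zero_def
  proof
    fix l
    show "coeff (poly_cutoff (Suc n) g - g) l \<in> mideal"
    proof (cases "l \<le> n \<or> l > degree g")
      case True
      then show ?thesis by (auto simp: coeff_poly_cutoff zero_mideal coeff_eq_0)
    next
      case False
      then have "l \<notin> U" using Max_ge[OF U(1), of l] n_def by auto
      then have "coeff g l \<in> mideal" using False assms(2) vunit_mem
        by (auto simp: U_def integral_poly_def)
      then show ?thesis using False by (simp add: coeff_poly_cutoff mideal_minus)
    qed
  qed
  then have "poly (poly_cutoff (Suc n) g - g) w \<in> mideal" using \<open>w \<in> V\<close> by (rule residue_zero_eval)
  then have "v - poly g w \<in> mideal" by (simp add: v_def)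
  then show ?thesis using units vunit_cong[of v "poly g w"] by blast
qed

text \<open>Takes the place of Hensel's lemma, without any condition on the derivative. If no root
  \<beta> were congruent to \<eta>, each |\<eta> - \<beta>| would be at least 1, hence at least |w -
  \<beta>|; multiplying over the roots, |h(w)| \<le> |h(\<eta>)| < 1, against the choice of
  \<open>w\<close>.\<close>

lemma root_near:
  assumes "alg_closed TYPE('k)" "\<eta> \<in> V" "w \<in> V" "poly h \<eta> \<in> mideal" "poly h w \<notin> mideal"
  shows "\<exists>\<xi>. poly h \<xi> = 0 \<and> \<xi> - \<eta> \<in> mideal"
proof (rule ccontr)
  assume *: "\<not> ?thesis"
  have "poly h w \<preceq> poly h \<eta>" if "\<And>\<beta>. poly h \<beta> = 0 \<Longrightarrow> \<beta> - \<eta> \<notin> mideal" for h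
    using that
  proof (induction "degree h" arbitrary: h)
    case 0
    then obtain c where "h = [:c:]" by (metis degree_eq_zeroE)
    then show ?case by (simp add: vle_refl)
  next
    case (Suc n)
    then obtain \<beta> where \<beta>: "poly h \<beta> = 0" using alg_closed_root[OF assms(1), of h] by auto
    then obtain q where q: "h = [:- \<beta>, 1:] * q" using poly_eq_0_iff_dvd by blast
    have "q \<noteq> 0" using q Suc.hyps by auto
    then have "degree h = Suc (degree q)" using q degree_mult_eq[of "[:- \<beta>, 1:]" q] by simp
    then have IH: "poly q w \<preceq> poly q \<eta>" using Suc q by auto
    have "\<beta> - \<eta> \<notin> mideal" using \<beta> Suc.prems by blast
    then have "\<eta> - \<beta> \<notin> mideal" using cong_sym[of \<eta> \<beta>] by blast
    then have 1: "1 \<preceq> \<eta> - \<beta>" unfolding mideal_iff vlt_def by simp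
    have "w - \<eta> \<preceq> 1" using diff_mem[OF assms(3,2)] by (simp add: vle_one_iff)
    then have "(w - \<eta>) + (\<eta> - \<beta>) \<preceq> \<eta> - \<beta>" by (intro vle_add[OF vle_trans[OF _ 1] vle_refl])
    then have "w - \<beta> \<preceq> \<eta> - \<beta>" by simp
    then have "(w - \<beta>) * poly q w \<preceq> (\<eta> - \<beta>) * poly q \<eta>" using IH by (rule vle_mult)
    then show ?case unfolding q by (simp add: algebra_simps)
  qed
  then have "poly h w \<preceq> poly h \<eta>" using * by blast
  then show False using assms(4,5) vle_vlt_trans[of "poly h w" "poly h \<eta>" 1] unfolding mideal_iff by blast
qed

end

text \<open>The logarithmic derivative with denominators cleared: the first factor holds the
  critical points forced by multiple roots, the second the remaining ones.\<close>

lemma pderiv_prod_linear_power: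
  fixes \<eta> :: "'k::field"
  assumes "finite T" "\<And>t. t \<in> T \<Longrightarrow> e t > 0"
  shows "poly (pderiv (\<Prod>t\<in>T. [:- t, 1:] ^ e t)) \<eta>
      = (\<Prod>t\<in>T. (\<eta> - t) ^ (e t - 1)) * (\<Sum>t\<in>T. of_nat (e t) * (\<Prod>s\<in>T - {t}. \<eta> - s))"
proof -
  have "poly (pderiv (\<Prod>t\<in>T. [:- t, 1:] ^ e t)) \<eta>
      = (\<Sum>t\<in>T. (\<Prod>s\<in>T - {t}. (\<eta> - s) ^ e s) * (of_nat (e t) * (\<eta> - t) ^ (e t - 1)))"
    by (simp add: pderiv_prod pderiv_power poly_sum poly_prod pderiv_pCons mult_ac)
  also have "\<dots> = (\<Sum>t\<in>T. (\<Prod>t\<in>T. (\<eta> - t) ^ (e t - 1)) * (of_nat (e t) * (\<Prod>s\<in>T - {t}. \<eta> - s)))"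
  proof (rule sum.cong[OF refl])
    fix t assume t: "t \<in> T"
    have "(\<Prod>s\<in>T - {t}. (\<eta> - s) ^ e s) = (\<Prod>s\<in>T - {t}. (\<eta> - s) ^ (e s - 1)) * (\<Prod>s\<in>T - {t}. \<eta> - s)"
      unfolding prod.distrib[symmetric] using assms(2)
      by (intro prod.cong refl) (metis DiffD1 power_minus_mult)
    moreover have "(\<Prod>t\<in>T. (\<eta> - t) ^ (e t - 1))
        = (\<eta> - t) ^ (e t - 1) * (\<Prod>s\<in>T - {t}. (\<eta> - s) ^ (e s - 1))"
      using assms(1) t by (rule prod.remove)
    ultimately show "(\<Prod>s\<in>T - {t}. (\<eta> - s) ^ e s) * (of_nat (e t) * (\<eta> - t) ^ (e t - 1))
        = (\<Prod>t\<in>T. (\<eta> - t) ^ (e t - 1)) * (of_nat (e t) * (\<Prod>s\<in>T - {t}. \<eta> - s))"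
      by (simp add: mult_ac)
  qed
  finally show ?thesis by (simp add: sum_distrib_left)
qed

context valuation_ring
begin

text \<open>A choice of representatives modulo the maximal ideal, so that congruent elements become equal.\<close>

definition rep :: "'k \<Rightarrow> 'k" where
  "rep x = (SOME y. y - x \<in> mideal)"

lemma rep_cong: "rep x - x \<in> mideal"
  unfolding rep_def by (rule someI[of _ x]) (simp add: zero_mideal)

lemma rep_eq:
  assumes "x - y \<in> mideal"
  shows "rep x = rep y"
proof -
  have "z - x \<in> mideal \<longleftrightarrow> z - y \<in> mideal" for z
    using cong_trans[of z x y] cong_trans[of z y x] assms cong_sym[of x y] by blast
  then show ?thesis unfolding rep_def by simp
qed

lemma rep_mem: "x \<in> V \<Longrightarrow> rep x \<in> V"
  using add_mem[OF mideal_mem[OF rep_cong[of x]], of x] by simp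

text \<open>A critical point whose critical value is a unit: if modulo the maximal ideal every critical
  point were a root, then with T the set of distinct roots and e their multiplicities, the factor
  \<Sum>t. e(t) \<Prod>s\<noteq>t. (X - s), of degree card T - 1 and without common root with p, would be
  constant, so that p would have a single root, which the vanishing coefficient forces to be 0.\<close>

lemma critical_point_unit_value:
  assumes ac: "alg_closed TYPE('k)"
    and deg: "degree p = d" "d \<ge> 2" "lead_coeff p = 1"
    and units: "\<And>j. 0 < j \<Longrightarrow> j \<le> d \<Longrightarrow> vunit (of_nat j)"
    and p: "integral_poly p" "coeff p (d - 1) = 0" "l < d" "vunit (coeff p l)"
  shows "\<exists>\<eta>\<in>V. vunit (poly p \<eta>) \<and> poly (pderiv p) \<eta> \<in> mideal"
proof -
  have "p \<noteq> 0" using deg by auto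
  then obtain rs where "p = smult (lead_coeff p) (\<Prod>r\<leftarrow>rs. [:- r, 1:])" "length rs = degree p"
    using alg_closed_split[OF ac, of p] by blast
  then have rs: "p = (\<Prod>r\<leftarrow>rs. [:- r, 1:])" "length rs = d"
    unfolding deg(3) smult_1_left unfolding deg(1) by -
  have rV: "r \<in> V" if "r \<in> set rs" for r
  proof (rule integral_mem[OF p(1)])
    show "vunit (lead_coeff p)" using deg(3) one_vunit by simp
    have "[:- r, 1:] dvd p" unfolding rs(1) using that
      by (metis (no_types, lifting) image_eqI list.set_map prod_list_dvd)
    then show "poly p r = 0" by (simp add: poly_eq_0_iff_dvd)
  qed
  \<comment> \<open>Replacing each root by its representative changes \<open>p\<close> only modulo
    \<open>mideal\<close> and makes congruent roots equal, so \<open>e\<close> counts multiplicities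
    of the reduction.\<close>
  define P where "P = (\<Prod>r\<leftarrow>map rep rs. [:- r, 1:])"
  define T where "T = rep ` set rs"
  define e where "e t = count_list (map rep rs) t" for t
  have T: "finite T" "T = set (map rep rs)" by (auto simp: T_def)
  have P: "P = (\<Prod>t\<in>T. [:- t, 1:] ^ e t)"
    unfolding P_def e_def using T by (intro prod_list_map_count) auto
  have epos: "e t > 0" if "t \<in> T" for t
    using that unfolding e_def T(2) by (metis count_list_0_iff gr0I)
  have esum: "sum e T = d"
    unfolding e_def using T by (subst sum_count_set) (auto simp: rs(2))
  have ele: "e t \<le> d" if "t \<in> T" for t
    using esum member_le_sum[of t T e] that T(1) by simp
  have TV: "t \<in> V" if "t \<in> T" for t using that rV rep_mem by (auto simp: T_def)
  have Tdiff: "vunit (s - t)" if stT: "s \<in> T" "t \<in> T" "s \<noteq> t" for s t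
  proof (rule vunit_mem)
    show "s - t \<in> V" using that TV diff_mem by blast
    show "s - t \<notin> mideal"
    proof
      assume st: "s - t \<in> mideal"
      obtain a b where ab: "s = rep a" "t = rep b" using stT by (auto simp: T_def)
      have "a - t \<in> mideal" using cong_trans[OF cong_sym[OF rep_cong] st[unfolded ab]] ab by simp
      then have "a - b \<in> mideal" using cong_trans[of a t b] rep_cong[of b] ab by simp
      then show False using rep_eq[of a b] ab stT(3) by simp
    qed
  qed
  have pP: "residue_zero (p - P)"
  proof -
    have "integral_poly (\<Prod>r\<leftarrow>map rep xs. [:- r, 1:]) \<and>
        residue_zero ((\<Prod>r\<leftarrow>xs. [:- r, 1:]) - (\<Prod>r\<leftarrow>map rep xs. [:- r, 1:]))"
      if "set xs \<subseteq> set rs" for xs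
      using that
    proof (induction xs)
      case Nil
      then show ?case by (simp add: integral_poly_one residue_zero_def zero_mideal)
    next
      case (Cons x xs)
      let ?A = "\<Prod>r\<leftarrow>xs. [:- r, 1:]" and ?B = "\<Prod>r\<leftarrow>map rep xs. [:- r, 1:]"
      have IH: "integral_poly ?B" "residue_zero (?A - ?B)" using Cons by auto
      have x: "x \<in> V" using Cons.prems rV by auto
      have 1: "integral_poly ([:- rep x, 1:] * ?B)"
        using IH(1) x by (intro integral_poly_mult integral_poly_linear rep_mem)
      have gen: "X * A - Y * B = (A - B) * X + (X - Y) * B" for X Y A B :: "'k poly"
        by (simp add: algebra_simps)
      have "residue_zero ([:- x, 1:] - [:- rep x, 1:])"
        using rep_cong by (auto simp: residue_zero_def coeff_pCons zero_mideal split: nat.split)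
      then have "residue_zero (([:- x, 1:] - [:- rep x, 1:]) * ?B)" using IH(1) by (rule residue_zero_mult)
      moreover have "residue_zero ((?A - ?B) * [:- x, 1:])"
        using IH(2) x by (intro residue_zero_mult integral_poly_linear)
      ultimately have 2: "residue_zero ([:- x, 1:] * ?A - [:- rep x, 1:] * ?B)"
        unfolding gen using residue_zero_add by blast
      show ?case using 1 2 by (simp only: list.map prod_list.Cons simp_thms)
    qed
    from this[of rs] show ?thesis unfolding P_def rs(1)[symmetric] by blast
  qed
  define n where "n = card T"
  have "T \<noteq> {}" using esum deg(2) by auto
  then have "n > 0" using T(1) by (simp add: n_def card_gt_0_iff)
  \<comment> \<open>A single root t makes \<open>P\<close> a d-th power, whose coefficient of degree
    d - 1 is -dt. The vanishing coefficient of \<open>p\<close> puts t into \<open>mideal\<close>,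
    and with it every lower coefficient, including the one at \<open>l\<close>.\<close>
  have "n \<noteq> 1"
  proof
    assume "n = 1"
    then obtain t where t: "T = {t}" unfolding n_def using card_1_singletonE by blast
    then have "P = [:- t, 1:] ^ d" using P esum by simp
    then have cP: "coeff P i = of_nat (d choose i) * (- t) ^ (d - i)" if "i \<le> d" for i
      using coeff_linear_poly_power[of i d "- t" 1] that by simp
    have "coeff (p - P) (d - 1) \<in> mideal" using pP unfolding residue_zero_def by blast
    moreover have "d choose (d - 1) = d"
      using binomial_symmetric[of "d - 1" d] deg(2) by simp
    ultimately
    have "of_nat d * t \<in> mideal"
      using cP[of "d - 1"] p(2) deg(2) by simp
    moreover have "vunit (of_nat d)" using units deg(2) by simp
    ultimately have "t \<in> mideal" using vunit_mult_mideal by blast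
    then have "coeff P l \<in> mideal" unfolding cP[OF less_imp_le[OF p(3)]] using p(3)
      by (intro mideal_mult' mideal_power mideal_minus of_nat_mem) auto
    moreover have "coeff p l - coeff P l \<in> mideal"
      using pP unfolding residue_zero_def by (metis coeff_diff)
    ultimately have "coeff p l \<in> mideal" using mideal_add by fastforce
    then show False using p(4) vunit_not_mideal by blast
  qed
  define q where "q = (\<Sum>t\<in>T. smult (of_nat (e t)) (\<Prod>s\<in>T - {t}. [:- s, 1:]))"
  have qe: "poly q x = (\<Sum>t\<in>T. of_nat (e t) * (\<Prod>s\<in>T - {t}. x - s))" for x
    by (simp add: q_def poly_sum poly_prod)
  have cT: "card (T - {t}) = n - 1" if "t \<in> T" for t
    using that T(1) by (simp add: n_def card_Diff_singleton)
  \<comment> \<open>Each product is monic of degree n - 1, so the leading coefficient is the sum of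
    the multiplicities, d. It is a unit: \<open>q\<close> keeps its degree modulo
    \<open>mideal\<close>, and its roots lie in \<open>V\<close>.\<close>
  have "coeff q (n - 1) = (\<Sum>t\<in>T. of_nat (e t))"
    unfolding q_def coeff_sum
  proof (intro sum.cong refl)
    fix t assume "t \<in> T"
    then show "coeff (smult (of_nat (e t)) (\<Prod>s\<in>T - {t}. [:- s, 1:])) (n - 1) = of_nat (e t)"
      using coeff_prod_linear(2)[of "T - {t}"] cT[of t] T(1) by simp
  qed
  also have "\<dots> = of_nat d" by (simp flip: of_nat_sum add: esum)
  finally have cq: "coeff q (n - 1) = of_nat d" .
  have ud: "vunit (of_nat d)" using units deg(2) by simp
  have "degree q \<le> n - 1" unfolding q_def
    by (intro degree_sum_le T(1) order.trans[OF degree_smult_le])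
      (metis T(1) cT coeff_prod_linear(1) finite_Diff order.refl)
  moreover have "n - 1 \<le> degree q"
    using cq ud by (intro le_degree) (auto simp: vunit_def)
  ultimately have dq: "degree q = n - 1" by simp
  then have "degree q = n - 1" .
  moreover have "1 \<le> n - 1" using \<open>n > 0\<close> \<open>n \<noteq> 1\<close> by linarith
  ultimately obtain \<eta> where \<eta>: "poly q \<eta> = 0"
    using alg_closed_root[OF ac, of q] by metis
  have vq: "integral_poly q"
  proof -
    have "integral_poly (\<Prod>s\<in>T - {t}. [:- s, 1:])" for t
      using TV by (intro integral_poly_prod integral_poly_linear) auto
    then show ?thesis unfolding integral_poly_def q_def coeff_sum coeff_smult
      by (auto intro!: sum_mem mult_mem of_nat_mem)
  qed
  have "\<eta> \<in> V" using integral_mem[OF vq _ \<eta>] ud unfolding dq cq by blast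
  \<comment> \<open>At a root \<open>t\<close> only the summand of \<open>t\<close> survives in
    \<open>q\<close>. It is a unit because 0 < \<open>e t\<close> \<le> d and the elements of
    \<open>T\<close> are incongruent, so a zero of \<open>q\<close> is incongruent to every
    root.\<close>
  have \<eta>T: "vunit (\<eta> - t)" if t: "t \<in> T" for t
  proof (rule vunit_mem)
    show "\<eta> - t \<in> V" using \<open>\<eta> \<in> V\<close> TV t diff_mem by blast
    show "\<eta> - t \<notin> mideal"
    proof
      assume "\<eta> - t \<in> mideal"
      then have "poly q \<eta> - poly q t \<in> mideal" using poly_cong_arg vq \<open>\<eta> \<in> V\<close> TV t by blast
      moreover have "poly q t = of_nat (e t) * (\<Prod>s\<in>T - {t}. t - s)"
      proof -
        have "(\<Sum>t'\<in>T - {t}. of_nat (e t') * (\<Prod>s\<in>T - {t'}. t - s)) = 0"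
          using t T(1) by (intro sum.neutral) auto
        then show ?thesis unfolding qe by (simp add: sum.remove[OF T(1) t])
      qed
      moreover have "vunit (of_nat (e t) * (\<Prod>s\<in>T - {t}. t - s))"
        using units epos ele t Tdiff by (intro vunit_mult vunit_prod) auto
      ultimately show False using \<eta> mideal_minus vunit_not_mideal by fastforce
    qed
  qed
  have "poly P \<eta> = (\<Prod>t\<in>T. (\<eta> - t) ^ e t)" by (simp add: P poly_prod)
  then have "vunit (poly P \<eta>)" using \<eta>T by (auto intro!: vunit_prod vunit_power)
  moreover have "poly P \<eta> - poly p \<eta> \<in> mideal"
    using cong_sym residue_zero_eval[OF pP \<open>\<eta> \<in> V\<close>] by simp
  ultimately have "vunit (poly p \<eta>)" by (rule vunit_cong)
  moreover have "poly (pderiv P) \<eta> = 0"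
    using pderiv_prod_linear_power[of T e \<eta>, OF T(1) epos] \<eta> unfolding P qe by simp
  then have "poly (pderiv p) \<eta> \<in> mideal"
    using residue_zero_eval[OF residue_zero_pderiv[OF pP] \<open>\<eta> \<in> V\<close>] by (simp add: pderiv_diff)
  ultimately show ?thesis using \<open>\<eta> \<in> V\<close> by blast
qed

end

section \<open>Forms and determinants\<close>

lemma finite_mons_deg: "finite (mons_deg N e)"
proof (rule finite_subset)
  show "mons_deg N e \<subseteq> {m. \<forall>i. (i \<in> {..N} \<longrightarrow> m i \<in> {..e}) \<and> (i \<notin> {..N} \<longrightarrow> m i = 0)}"
  proof clarify
    fix m i assume "m \<in> mons_deg N e"
    then have m: "(\<Sum>i\<le>N. m i) = e" "\<forall>i>N. m i = 0" by (auto simp: mons_deg_def)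
    then show "(i \<in> {..N} \<longrightarrow> m i \<in> {..e}) \<and> (i \<notin> {..N} \<longrightarrow> m i = 0)"
      using member_le_sum[of i "{..N}" m] by auto
  qed
  show "finite {m. \<forall>i. (i \<in> {..N} \<longrightarrow> m i \<in> {..e}) \<and> (i \<notin> {..N} \<longrightarrow> m i = (0::nat))}"
    by (rule finite_set_of_finite_funs) auto
qed

lemma mons_deg_le: "m \<in> mons_deg N e \<Longrightarrow> m b \<le> e"
  using member_le_sum[of b "{..N}" m] by (cases "b \<le> N") (auto simp: mons_deg_def)

lemma mono_pow_mons_deg: "i \<le> N \<Longrightarrow> mono_pow i e \<in> mons_deg N e"
  by (auto simp: mons_deg_def mono_pow_def)

lemma mons_deg_full:
  assumes "m \<in> mons_deg N e" "i \<le> N" "m i = e"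
  shows "m = mono_pow i e"
proof
  fix j
  have "(\<Sum>j\<le>N. m j) = m i + (\<Sum>j\<in>{..N} - {i}. m j)" using assms(2) by (intro sum.remove) auto
  then have "(\<Sum>j\<in>{..N} - {i}. m j) = 0" using assms by (simp add: mons_deg_def)
  then show "m j = mono_pow i e j"
    using assms by (cases "j \<le> N") (auto simp: mono_pow_def mons_deg_def)
qed

lemma prod_mono_pow: "i \<le> N \<Longrightarrow> (\<Prod>b\<le>N. x b ^ mono_pow i e b) = (x i ^ e :: 'a::comm_ring_1)"
  by (simp add: mono_pow_def if_distrib[of "\<lambda>k. _ ^ k"] cong: if_cong)

lemma eval_form_cong: "(\<And>b. b \<le> N \<Longrightarrow> x b = y b) \<Longrightarrow> eval_form N e c x = eval_form N e c y"
  unfolding eval_form_def by (intro sum.cong prod.cong arg_cong2[of _ _ _ _ "(*)"]) auto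

lemma eval_form_scale:
  "eval_form N e c (\<lambda>b. S b * w b) = eval_form N e (\<lambda>m. c m * (\<Prod>b\<le>N. S b ^ m b)) w"
  by (simp add: eval_form_def power_mult_distrib prod.distrib mult.assoc)

lemma eval_form_smult: "eval_form N e (\<lambda>m. a * c m) x = a * eval_form N e c x"
  by (simp add: eval_form_def sum_distrib_left mult.assoc)

lemma eval_form_add: "eval_form N e (\<lambda>m. c m + c' m) x = eval_form N e c x + eval_form N e c' x"
  by (simp add: eval_form_def sum.distrib distrib_right)

lemma eval_form_homogeneous: "eval_form N e c (\<lambda>b. a * x b) = a ^ e * eval_form N e c x"
proof -
  have "(\<Prod>b\<le>N. a ^ m b) = a ^ e" if "m \<in> mons_deg N e" for m
    using that by (simp add: mons_deg_def flip: power_sum)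
  then have "eval_form N e c (\<lambda>b. a * x b) = eval_form N e (\<lambda>m. a ^ e * c m) x"
    unfolding eval_form_scale by (auto simp: eval_form_def intro!: sum.cong)
  then show ?thesis by (simp add: eval_form_smult)
qed

lemma eval_form_mono_pow:
  assumes "i \<le> N" "\<And>m. m \<in> mons_deg N e \<Longrightarrow> c m = (if m = mono_pow i e then 1 else 0)"
  shows "eval_form N e c x = x i ^ e"
proof -
  have "eval_form N e c x = (\<Sum>m\<in>mons_deg N e. if m = mono_pow i e then x i ^ e else 0)"
    unfolding eval_form_def using assms prod_mono_pow[of i N x e] by (intro sum.cong) auto
  then show ?thesis using finite_mons_deg mono_pow_mons_deg[OF assms(1)] by simp
qed

lemma eval_pderiv_form:
  assumes "e \<ge> 1" "b \<le> N"
  shows "eval_form N (e - 1) (pderiv_form b c) y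
    = (\<Sum>m\<in>mons_deg N e. c m * (of_nat (m b) * y b ^ (m b - 1) * (\<Prod>a\<in>{..N} - {b}. y a ^ m a)))"
proof -
  let ?g = "\<lambda>m. c m * (of_nat (m b) * y b ^ (m b - 1) * (\<Prod>a\<in>{..N} - {b}. y a ^ m a))"
  have "(\<Sum>m\<in>mons_deg N e. ?g m) = (\<Sum>m\<in>{m\<in>mons_deg N e. m b > 0}. ?g m)"
    using finite_mons_deg by (intro sum.mono_neutral_right) auto
  also have "\<dots> = eval_form N (e - 1) (pderiv_form b c) y"
    unfolding eval_form_def
  proof (rule sum.reindex_bij_witness[where i = "\<lambda>m. m(b := m b + 1)" and j = "\<lambda>m. m(b := m b - 1)"])
    fix m assume "m \<in> {m\<in>mons_deg N e. m b > 0}"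
    then have m: "m \<in> mons_deg N e" "m b > 0" by auto
    show "(m(b := m b - 1))(b := (m(b := m b - 1)) b + 1) = m" using m by auto
    have "(\<Sum>i\<le>N. m i) = m b + (\<Sum>i\<in>{..N} - {b}. m i)"
      using assms by (intro sum.remove) auto
    moreover have "(\<Sum>i\<le>N. (m(b := m b - 1)) i) = (m b - 1) + (\<Sum>i\<in>{..N} - {b}. m i)"
      using assms by (subst sum.remove[of _ b]) auto
    ultimately show "m(b := m b - 1) \<in> mons_deg N (e - 1)"
      using m assms by (auto simp: mons_deg_def)
    have "(\<Prod>a\<le>N. y a ^ (m(b := m b - 1)) a) = y b ^ (m b - 1) * (\<Prod>a\<in>{..N} - {b}. y a ^ m a)"
      using assms by (subst prod.remove[of _ b]) auto
    then show "pderiv_form b c (m(b := m b - 1)) * (\<Prod>a\<le>N. y a ^ (m(b := m b - 1)) a) = ?g m"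
      using m by (simp add: pderiv_form_def mult_ac)
  next
    fix m assume m: "m \<in> mons_deg N (e - 1)"
    show "(m(b := m b + 1))(b := (m(b := m b + 1)) b - 1) = m" by auto
    have "(\<Sum>i\<le>N. m i) = m b + (\<Sum>i\<in>{..N} - {b}. m i)"
      using assms by (intro sum.remove) auto
    moreover have "(\<Sum>i\<le>N. (m(b := m b + 1)) i) = (m b + 1) + (\<Sum>i\<in>{..N} - {b}. m i)"
      using assms by (subst sum.remove[of _ b]) auto
    ultimately show "m(b := m b + 1) \<in> {m\<in>mons_deg N e. m b > 0}"
      using m assms by (auto simp: mons_deg_def)
  qed
  finally show ?thesis by simp
qed

section \<open>Restriction of forms to lines\<close>

lemma pderiv_sum: "pderiv (sum g A) = (\<Sum>a\<in>A. pderiv (g a))"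
  by (induction A rule: infinite_finite_induct) (auto simp: pderiv_add)

text \<open>The form along x + t v as a polynomial in t: \<open>eval_form\<close> is reused with
  coefficients and arguments in the polynomial ring. Differentiating it reduces the chain rule for
  forms to one variable.\<close>

definition line_poly :: "nat \<Rightarrow> nat \<Rightarrow> 'k::field mpoly \<Rightarrow> (nat \<Rightarrow> 'k) \<Rightarrow> (nat \<Rightarrow> 'k) \<Rightarrow> 'k poly" where
  "line_poly N e c x v = eval_form N e (\<lambda>m. [:c m:]) (\<lambda>b. [:x b, v b:])"

lemma poly_eval_form: "poly (eval_form N e c X) t = eval_form N e (\<lambda>m. poly (c m) t) (\<lambda>b. poly (X b) t)"
  by (simp add: eval_form_def poly_sum poly_prod)

lemma poly_line_poly: "poly (line_poly N e c x v) t = eval_form N e c (\<lambda>b. x b + t * v b)"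
  by (simp add: line_poly_def poly_eval_form)

lemma poly_pderiv_line_poly:
  assumes "e \<ge> 1"
  shows "poly (pderiv (line_poly N e c x v)) t
    = (\<Sum>b\<le>N. v b * eval_form N (e - 1) (pderiv_form b c) (\<lambda>a. x a + t * v a))"
proof -
  let ?y = "\<lambda>a. x a + t * v a"
  have "poly (pderiv (line_poly N e c x v)) t
      = (\<Sum>m\<in>mons_deg N e. c m * (\<Sum>b\<le>N. (\<Prod>a\<in>{..N} - {b}. ?y a ^ m a) * (of_nat (m b) * ?y b ^ (m b - 1) * v b)))"
    by (simp add: line_poly_def eval_form_def pderiv_sum pderiv_smult pderiv_prod pderiv_power
      poly_sum poly_prod pderiv_pCons mult_ac)
  also have "\<dots> = (\<Sum>b\<le>N. \<Sum>m\<in>mons_deg N e.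
      v b * (c m * (of_nat (m b) * ?y b ^ (m b - 1) * (\<Prod>a\<in>{..N} - {b}. ?y a ^ m a))))"
    unfolding sum_distrib_left by (subst sum.swap) (simp add: mult_ac)
  also have "\<dots> = (\<Sum>b\<le>N. v b * eval_form N (e - 1) (pderiv_form b c) ?y)"
    unfolding sum_distrib_left[symmetric]
    by (intro sum.cong refl arg_cong2[of _ _ _ _ "(*)"] eval_pderiv_form[OF assms, symmetric]) simp
  finally show ?thesis .
qed

text \<open>The lowest base-B digit is the remainder modulo B, and the others follow by induction.
  This keeps distinct monomials apart under Kronecker substitution.\<close>

lemma digits_inj:
  fixes m m' :: "nat \<Rightarrow> nat"
  assumes "\<And>b. b \<le> N \<Longrightarrow> m b < B" "\<And>b. b \<le> N \<Longrightarrow> m' b < B"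
    and "(\<Sum>b\<le>N. B ^ b * m b) = (\<Sum>b\<le>N. B ^ b * m' b)" "b \<le> N"
  shows "m b = m' b"
  using assms
proof (induction N arbitrary: m m' b)
  case (Suc N)
  have split: "(\<Sum>b\<le>Suc N. B ^ b * h b) = h 0 + B * (\<Sum>b\<le>N. B ^ b * h (Suc b))" for h :: "nat \<Rightarrow> nat"
    by (simp add: sum.atMost_Suc_shift sum_distrib_left mult_ac del: sum.atMost_Suc)
  have B: "m 0 < B" "m' 0 < B" using Suc.prems by auto
  have eq: "m 0 + B * (\<Sum>b\<le>N. B ^ b * m (Suc b)) = m' 0 + B * (\<Sum>b\<le>N. B ^ b * m' (Suc b))"
    using Suc.prems(3) unfolding split .
  from arg_cong[OF eq, of "\<lambda>n. n mod B"] have 0: "m 0 = m' 0" using B by simp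
  with eq B have "(\<Sum>b\<le>N. B ^ b * m (Suc b)) = (\<Sum>b\<le>N. B ^ b * m' (Suc b))" by simp
  then have "m (Suc b) = m' (Suc b)" if "b \<le> N" for b
    using Suc.IH[of "\<lambda>b. m (Suc b)" "\<lambda>b. m' (Suc b)" b] Suc.prems(1,2) that by simp
  then show ?case using 0 Suc.prems(4) by (cases b) auto
qed auto

section \<open>Determinants\<close>

lemma detn_scale:
  "detn n (\<lambda>i j. r i * k j * M i j) = (\<Prod>i<n. r i) * (\<Prod>j<n. k j) * detn n M"
  unfolding detn_def sum_distrib_left
proof (rule sum.cong[OF refl])
  fix p assume "p \<in> {p. p permutes {..<n}}"
  then have "(\<Prod>j<n. k j) = (\<Prod>i<n. k (p i))" using prod.permute[of p "{..<n}" k] by (simp add: o_def)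
  then show "of_int (sign p) * (\<Prod>i<n. r i * k (p i) * M i (p i))
      = (\<Prod>i<n. r i) * (\<Prod>j<n. k j) * (of_int (sign p) * (\<Prod>i<n. M i (p i)))"
    by (simp add: prod.distrib mult_ac)
qed

lemma detn_cong: "(\<And>i j. i < n \<Longrightarrow> j < n \<Longrightarrow> A i j = B i j) \<Longrightarrow> detn n A = detn n B"
  unfolding detn_def
proof (intro sum.cong refl arg_cong2[of _ _ _ _ "(*)"] prod.cong)
  fix p i assume "\<And>i j. i < n \<Longrightarrow> j < n \<Longrightarrow> A i j = B i j"
    "p \<in> {p. p permutes {..<n}}" "i \<in> {..<n}"
  then show "A i (p i) = B i (p i)" using permutes_in_image[of p "{..<n}" i] by auto
qed

lemma detn_det: "detn n A = det (mat n n (\<lambda>(i, j). A i j))"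
proof -
  have "(\<Prod>i<n. A i (p i)) = (\<Prod>i = 0..<n. mat n n (\<lambda>(i, j). A i j) $$ (i, p i))"
    if "p permutes {..<n}" for p
    unfolding lessThan_atLeast0 using permutes_in_image[OF that] by (intro prod.cong) auto
  then show ?thesis
    unfolding detn_def det_def by (auto simp: lessThan_atLeast0 intro!: sum.cong)
qed

lemma detn_mult: "detn n (\<lambda>i j. \<Sum>k<n. A i k * B k j) = detn n A * detn n B"
proof -
  have "mat n n (\<lambda>(i, j). A i j) * mat n n (\<lambda>(i, j). B i j) = mat n n (\<lambda>(i, j). \<Sum>k<n. A i k * B k j)"
    by (rule eq_matI) (auto simp: scalar_prod_def lessThan_atLeast0)
  then show ?thesis unfolding detn_det by (subst det_mult[of _ n, symmetric]) auto
qed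

lemma poly_detn: "poly (detn n M) t = detn n (\<lambda>i j. poly (M i j) t)"
  by (simp add: detn_def poly_sum poly_prod)

context valuation_ring
begin

text \<open>Kronecker substitution reduces generic values of several variables to one variable.\<close>

lemma generic_units:
  fixes N :: nat
  assumes "alg_closed TYPE('k)" "finite M" "\<And>m b. m \<in> M \<Longrightarrow> b > N \<Longrightarrow> m b = 0"
    and "\<And>m. m \<in> M \<Longrightarrow> c m \<in> V" "\<mu> \<in> M" "vunit (c \<mu>)"
  shows "\<exists>u. (\<forall>b. vunit (u b)) \<and> vunit (\<Sum>m\<in>M. c m * (\<Prod>b\<le>N. u b ^ m b))"
proof -
  define B where "B = Suc (\<Sum>m\<in>M. \<Sum>b\<le>N. m b)"
  have B: "m b < B" if "m \<in> M" "b \<le> N" for m b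
  proof -
    have "m b \<le> (\<Sum>b\<le>N. m b)" using that by (intro member_le_sum) auto
    also have "\<dots> \<le> (\<Sum>m\<in>M. \<Sum>b\<le>N. m b)" using that assms(2) by (intro member_le_sum) auto
    finally show ?thesis by (simp add: B_def)
  qed
  define enc where "enc m = (\<Sum>b\<le>N. B ^ b * m b)" for m :: "nat \<Rightarrow> nat"
  have inj: "m = m'" if "m \<in> M" "m' \<in> M" "enc m = enc m'" for m m'
  proof
    fix b show "m b = m' b"
    proof (cases "b \<le> N")
      case True
      then show ?thesis using that B digits_inj[of N m B m' b] by (simp add: enc_def)
    next
      case False
      then show ?thesis using that assms(3)[of m b] assms(3)[of m' b] by simp
    qed
  qed
  define g where "g = (\<Sum>m\<in>M. monom (c m) (enc m))"
  have "integral_poly g" unfolding integral_poly_def g_def coeff_sum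
    using assms(4) by (auto intro!: sum_mem simp: zero_mem)
  moreover have "coeff g (enc \<mu>) = c \<mu>"
  proof -
    have "coeff g (enc \<mu>) = (\<Sum>m\<in>M. if m = \<mu> then c m else 0)"
      unfolding g_def coeff_sum coeff_monom using inj assms(5) by (intro sum.cong) auto
    then show ?thesis using assms(2,5) by simp
  qed
  ultimately obtain w where w: "vunit w" "vunit (poly g w)"
    using unit_value[OF assms(1), of g "enc \<mu>"] assms(6) by auto
  have "poly g w = (\<Sum>m\<in>M. c m * (\<Prod>b\<le>N. (w ^ (B ^ b)) ^ m b))"
    by (simp add: g_def poly_sum poly_monom enc_def power_sum power_mult)
  then show ?thesis using w vunit_power by (intro exI[of _ "\<lambda>b. w ^ (B ^ b)"]) auto
qed

text \<open>A permutation other than the identity moves at least two indices, so it moves one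
  outside \<open>i0\<close>; the factor of its product in that row lies in \<open>mideal\<close>.
  Row \<open>i0\<close> stays free because it will be the row that does not reduce to the power
  map.\<close>

lemma detn_diag_cong:
  assumes "\<And>i j. i < n \<Longrightarrow> j < n \<Longrightarrow> M i j \<in> V"
    and "\<And>i j. i < n \<Longrightarrow> j < n \<Longrightarrow> i \<noteq> i0 \<Longrightarrow> j \<noteq> i \<Longrightarrow> M i j \<in> mideal"
  shows "detn n M - (\<Prod>i<n. M i i) \<in> mideal"
proof -
  have fin: "finite {p. p permutes {..<n}}" by (simp add: finite_permutations)
  have id: "id \<in> {p. p permutes {..<n}}" by (simp add: permutes_id)
  have "of_int (sign p) * (\<Prod>i<n. M i (p i)) \<in> mideal"
    if p: "p \<in> {p. p permutes {..<n}} - {id}" for p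
  proof -
    have perm: "p permutes {..<n}" "p \<noteq> id" using p by auto
    have im: "p i < n" if "i < n" for i using permutes_in_image[OF perm(1), of i] that by auto
    have "\<exists>i<n. i \<noteq> i0 \<and> p i \<noteq> i"
    proof (rule ccontr)
      assume *: "\<not> ?thesis"
      have fix1: "p i = i" if "i \<noteq> i0" for i
        using * that permutes_not_in[OF perm(1), of i] by (cases "i < n") auto
      have "p i0 = i0" using fix1[of "p i0"] permutes_inj[OF perm(1)] by (metis injD)
      then show False using fix1 perm(2) by (metis eq_id_iff)
    qed
    then obtain i where "i < n" "i \<noteq> i0" "p i \<noteq> i" by blast
    then have "(\<Prod>i<n. M i (p i)) \<in> mideal"
      using assms im by (intro mideal_prod[of _ _ i]) auto
    then show ?thesis by (intro mideal_mult' of_int_mem)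
  qed
  then have "(\<Sum>p\<in>{p. p permutes {..<n}} - {id}. of_int (sign p) * (\<Prod>i<n. M i (p i))) \<in> mideal"
    by (rule mideal_sum)
  moreover have "detn n M = (\<Prod>i<n. M i i)
      + (\<Sum>p\<in>{p. p permutes {..<n}} - {id}. of_int (sign p) * (\<Prod>i<n. M i (p i)))"
    unfolding detn_def sum.remove[OF fin id] by (simp add: sign_id)
  ultimately show ?thesis by simp
qed

end

text \<open>For the trivial valuation ring the units are the nonzero elements, so
  \<open>generic_units\<close> yields a point where a form with a nonzero coefficient does not
  vanish.\<close>

lemma form_coeff_zero:
  fixes c :: "'k::field mpoly"
  assumes "alg_closed TYPE('k)" "\<And>x. eval_form N e c x = 0" "m \<in> mons_deg N e"
  shows "c m = 0"
proof (rule ccontr)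
  assume "c m \<noteq> 0"
  interpret trivial: valuation_ring "UNIV :: 'k set" by unfold_locales auto
  have "\<exists>u. (\<forall>b. trivial.vunit (u b)) \<and> trivial.vunit (\<Sum>m\<in>mons_deg N e. c m * (\<Prod>b\<le>N. u b ^ m b))"
    using \<open>c m \<noteq> 0\<close> assms(3)
    by (intro trivial.generic_units[OF assms(1) finite_mons_deg]) (auto simp: mons_deg_def trivial.vunit_def)
  then show False using assms(2) by (auto simp: eval_form_def trivial.vunit_def)
qed

section \<open>Dynamics at a given scale\<close>

definition jac :: "nat \<Rightarrow> nat \<Rightarrow> (nat \<Rightarrow> 'k::comm_ring_1 mpoly) \<Rightarrow> (nat \<Rightarrow> 'k) \<Rightarrow> 'k" where
  "jac N d f x = detn (Suc N) (\<lambda>i j. eval_form N (d - 1) (pderiv_form j (f i)) x)"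

lemma ram_locus_jac: "ram_locus N d f = {x \<in> pts N. jac N d f x = 0}"
  by (simp add: ram_locus_def jac_def)

text \<open>The map in coordinates of size 1, with source coordinates divided by \<open>S b\<close>
  and target coordinates by \<open>S a ^ d\<close>. It is in general not a conjugate of
  \<open>f\<close>: the power map takes sizes S to sizes S^d, so the two scales differ.\<close>

definition scaled :: "nat \<Rightarrow> nat \<Rightarrow> (nat \<Rightarrow> 'k::field mpoly) \<Rightarrow> (nat \<Rightarrow> 'k) \<Rightarrow> nat \<Rightarrow> 'k mpoly" where
  "scaled N d f S a m = f a m * (\<Prod>b\<le>N. S b ^ m b) / S a ^ d"

lemma eval_scaled:
  assumes "S a \<noteq> 0"
  shows "eval_form N d (f a) (\<lambda>b. S b * w b) = S a ^ d * eval_form N d (scaled N d f S a) w"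
  unfolding eval_form_scale eval_form_smult[symmetric] scaled_def using assms by simp

lemma eval_pderiv_scaled:
  assumes "S a \<noteq> 0" "S b \<noteq> 0" "b \<le> N"
  shows "eval_form N e (pderiv_form b (f a)) (\<lambda>b. S b * w b)
    = S a ^ d * inverse (S b) * eval_form N e (pderiv_form b (scaled N d f S a)) w"
proof -
  have *: "(\<Prod>c\<le>N. S c ^ (m(b := m b + 1)) c) = S b * (\<Prod>c\<le>N. S c ^ m c)" for m
  proof -
    have "(\<Prod>c\<le>N. S c ^ (m(b := m b + 1)) c) = S b ^ (m b + 1) * (\<Prod>c\<in>{..N} - {b}. S c ^ m c)"
      using assms(3) by (subst prod.remove[of _ b]) auto
    also have "\<dots> = S b * (\<Prod>c\<le>N. S c ^ m c)"
      using assms(3) by (subst prod.remove[of "{..N}" b]) auto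
    finally show ?thesis .
  qed
  show ?thesis
    unfolding eval_form_scale eval_form_smult[symmetric] pderiv_form_def scaled_def *
    using assms by (intro arg_cong2[of _ _ _ _ "eval_form N e"] refl ext) (simp add: field_simps)
qed

lemma jac_scaled:
  assumes "\<And>a. a \<le> N \<Longrightarrow> S a \<noteq> 0"
  shows "jac N d f (\<lambda>b. S b * w b)
    = (\<Prod>a<Suc N. S a ^ d) * (\<Prod>b<Suc N. inverse (S b)) * jac N d (scaled N d f S) w"
  unfolding jac_def detn_scale[symmetric]
  using assms by (intro detn_cong eval_pderiv_scaled) auto

lemma jac_homogeneous:
  assumes "c \<noteq> (0 :: 'k::field)"
  shows "jac N d f (\<lambda>b. c * x b) = (\<Prod>a<Suc N. c ^ (d - 1)) * jac N d f x"
  using detn_scale[of "Suc N" "\<lambda>_. c ^ (d - 1)" "\<lambda>_. 1" "\<lambda>i j. eval_form N (d - 1) (pderiv_form j (f i)) x"]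
  by (simp add: jac_def eval_form_homogeneous)

context valuation_ring
begin

lemma vunit_cong': "vunit a \<Longrightarrow> b - a \<in> mideal \<Longrightarrow> vunit b"
  using vunit_cong[of a b] cong_sym[of b a] by blast

lemma eval_form_mem:
  assumes "\<And>m. m \<in> mons_deg N e \<Longrightarrow> c m \<in> V" "\<And>b. b \<le> N \<Longrightarrow> w b \<in> V"
  shows "eval_form N e c w \<in> V"
  unfolding eval_form_def using assms by (auto intro!: sum_mem mult_mem prod_mem power_mem)

lemma eval_form_coeff_cong:
  assumes "\<And>m. m \<in> mons_deg N e \<Longrightarrow> c m - c' m \<in> mideal" "\<And>b. b \<le> N \<Longrightarrow> w b \<in> V"
  shows "eval_form N e c w - eval_form N e c' w \<in> mideal"
proof -
  have "eval_form N e c w - eval_form N e c' w = (\<Sum>m\<in>mons_deg N e. (c m - c' m) * (\<Prod>i\<le>N. w i ^ m i))"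
    by (simp add: eval_form_def sum_subtractf left_diff_distrib)
  then show ?thesis using assms by (auto intro!: mideal_sum mideal_mult prod_mem power_mem)
qed

text \<open>Row \<open>a\<close> of a map that over the residue field acts in this row as the power
  map.\<close>

definition reduces :: "nat \<Rightarrow> nat \<Rightarrow> nat \<Rightarrow> 'k mpoly \<Rightarrow> bool" where
  "reduces N d a c \<longleftrightarrow> c (mono_pow a d) = 1 \<and> (\<forall>m\<in>mons_deg N d. m \<noteq> mono_pow a d \<longrightarrow> c m \<in> mideal)"

lemma reduces_eval:
  assumes "reduces N d a c" "a \<le> N" "\<And>b. b \<le> N \<Longrightarrow> w b \<in> V"
  shows "eval_form N d c w - w a ^ d \<in> mideal"
proof -
  have "eval_form N d (\<lambda>m. if m = mono_pow a d then 1 else 0) w = w a ^ d"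
    using assms(2) by (intro eval_form_mono_pow) auto
  moreover have "eval_form N d c w - eval_form N d (\<lambda>m. if m = mono_pow a d then 1 else 0) w \<in> mideal"
    using assms by (intro eval_form_coeff_cong) (auto simp: reduces_def zero_mideal)
  ultimately show ?thesis by simp
qed

lemma pderiv_form_mem:
  assumes "\<And>m. m \<in> mons_deg N d \<Longrightarrow> c m \<in> V" "d \<ge> 1" "b \<le> N" "m \<in> mons_deg N (d - 1)"
  shows "pderiv_form b c m \<in> V"
proof -
  have "(\<Sum>i\<le>N. (m(b := m b + 1)) i) = Suc (\<Sum>i\<le>N. m i)"
    using assms(3) by (simp add: sum.remove[of "{..N}" b])
  then have "m(b := m b + 1) \<in> mons_deg N d" using assms(2-4) by (auto simp: mons_deg_def)
  then show ?thesis unfolding pderiv_form_def using assms(1) by (intro mult_mem of_nat_mem) auto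
qed

lemma reduces_pderiv:
  assumes "reduces N d a c" "d \<ge> 1" "a \<le> N" "b \<le> N" "\<And>b. b \<le> N \<Longrightarrow> w b \<in> V"
  shows "eval_form N (d - 1) (pderiv_form b c) w - (if b = a then of_nat d * w a ^ (d - 1) else 0) \<in> mideal"
proof -
  let ?c = "\<lambda>m. (if b = a then of_nat d else 0) * (if m = mono_pow a (d - 1) then 1 else 0)"
  have "eval_form N (d - 1) (\<lambda>m. if m = mono_pow a (d - 1) then 1 else 0) w = w a ^ (d - 1)"
    using assms(3) by (intro eval_form_mono_pow) auto
  then have "eval_form N (d - 1) ?c w = (if b = a then of_nat d * w a ^ (d - 1) else 0)"
    unfolding eval_form_smult by simp
  moreover have "eval_form N (d - 1) (pderiv_form b c) w - eval_form N (d - 1) ?c w \<in> mideal"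
  proof (rule eval_form_coeff_cong)
    fix m assume m: "m \<in> mons_deg N (d - 1)"
    have "(\<Sum>i\<le>N. (m(b := m b + 1)) i) = Suc (\<Sum>i\<le>N. m i)"
      using assms(4) by (simp add: sum.remove[of "{..N}" b])
    then have m': "m(b := m b + 1) \<in> mons_deg N d" using m assms(2,4) by (auto simp: mons_deg_def)
    show "pderiv_form b c m - ?c m \<in> mideal"
    proof (cases "m(b := m b + 1) = mono_pow a d")
      case True
      then have "(m(b := m b + 1)) b = mono_pow a d b" by simp
      then have [simp]: "b = a" and d: "m a + 1 = d" by (auto simp: mono_pow_def split: if_splits)
      have "m x = mono_pow a (d - 1) x" for x
        using fun_cong[OF True, of x] d by (auto simp: mono_pow_def split: if_splits)
      then have "m = mono_pow a (d - 1)" by (rule ext)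
      moreover have "pderiv_form b c m = of_nat d"
        using assms(1) d True by (simp add: pderiv_form_def reduces_def flip: of_nat_Suc)
      ultimately show ?thesis by (simp add: zero_mideal)
    next
      case False
      have "(mono_pow a (d - 1))(a := mono_pow a (d - 1) a + 1) = mono_pow a d"
        using assms(2) by (auto simp: mono_pow_def)
      then have "\<not> (b = a \<and> m = mono_pow a (d - 1))" using False by auto
      then have z: "?c m = 0" by auto
      have "pderiv_form b c m \<in> mideal" unfolding pderiv_form_def
        using assms(1) m' False by (intro mideal_mult' of_nat_mem) (auto simp: reduces_def)
      then show ?thesis unfolding z diff_zero .
    qed
  qed (use assms in auto)
  ultimately show ?thesis by simp
qed

lemma reduces_mem:
  "reduces N d a c \<Longrightarrow> m \<in> mons_deg N d \<Longrightarrow> c m \<in> V"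
  unfolding reduces_def using one_mem mideal_mem by (cases "m = mono_pow a d") auto

lemma jac_near_diag:
  assumes "d \<ge> 1" "\<And>a m. a \<le> N \<Longrightarrow> m \<in> mons_deg N d \<Longrightarrow> G a m \<in> V"
    and "\<And>a. a \<le> N \<Longrightarrow> a \<noteq> i \<Longrightarrow> reduces N d a (G a)"
    and "\<And>b. b \<le> N \<Longrightarrow> w b \<in> V"
  shows "jac N d G w - (\<Prod>a<Suc N. eval_form N (d - 1) (pderiv_form a (G a)) w) \<in> mideal"
  unfolding jac_def
proof (rule detn_diag_cong)
  fix a b assume ab: "a < Suc N" "b < Suc N"
  show "eval_form N (d - 1) (pderiv_form b (G a)) w \<in> V"
    using ab assms by (intro eval_form_mem pderiv_form_mem) auto
  assume "a \<noteq> i" "b \<noteq> a"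
  then show "eval_form N (d - 1) (pderiv_form b (G a)) w \<in> mideal"
    using reduces_pderiv[of N d a "G a" b w] ab assms by auto
qed

lemma diag_pderiv_unit:
  assumes "reduces N d a c" "d \<ge> 1" "a \<le> N" "\<And>b. b \<le> N \<Longrightarrow> w b \<in> V"
    "vunit (w a)" "vunit (of_nat d)"
  shows "vunit (eval_form N (d - 1) (pderiv_form a c) w)"
proof (rule vunit_cong')
  show "vunit (of_nat d * w a ^ (d - 1))" using assms(5,6) by (intro vunit_mult vunit_power)
  show "eval_form N (d - 1) (pderiv_form a c) w - of_nat d * w a ^ (d - 1) \<in> mideal"
    using reduces_pderiv[OF assms(1-3) assms(3), of w] assms(4) by simp
qed

text \<open>Points whose coordinates have exactly the sizes S, up to a common factor; the factor
  makes the set a cone, to match the scaling-invariant sets of \<open>map_image\<close>.\<close>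

definition box :: "nat \<Rightarrow> (nat \<Rightarrow> 'k) \<Rightarrow> (nat \<Rightarrow> 'k) set" where
  "box N S = {y. \<exists>c w. c \<noteq> 0 \<and> (\<forall>b\<le>N. vunit (w b) \<and> y b = c * (S b * w b))}"

lemma box_scale: "y \<in> box N S \<Longrightarrow> c \<noteq> 0 \<Longrightarrow> (\<lambda>b. c * y b) \<in> box N S"
  unfolding box_def
proof clarify
  fix c' w assume "c \<noteq> 0" "c' \<noteq> 0" "\<forall>b\<le>N. vunit (w b) \<and> y b = c' * (S b * w b)"
  then show "\<exists>c'' w. c'' \<noteq> 0 \<and> (\<forall>b\<le>N. vunit (w b) \<and> c * y b = c'' * (S b * w b))"
    by (intro exI[of _ "c * c'"] exI[of _ w]) auto
qed

text \<open>Over the residue field the Jacobian of the power map is d^(N+1) times a product of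
  powers of the coordinates, all of them units here.\<close>

lemma box_jac:
  assumes "d \<ge> 1" "vunit (of_nat d)" "\<And>a. a \<le> N \<Longrightarrow> S a \<noteq> 0"
    and red: "\<And>a. a \<le> N \<Longrightarrow> reduces N d a (scaled N d f S a)"
    and "y \<in> box N S"
  shows "jac N d f y \<noteq> 0"
proof -
  obtain c w where cw: "c \<noteq> 0" "\<And>b. b \<le> N \<Longrightarrow> vunit (w b)" "\<And>b. b \<le> N \<Longrightarrow> y b = c * (S b * w b)"
    using assms(5) unfolding box_def by blast
  have wV: "w b \<in> V" if "b \<le> N" for b using cw(2) that by (simp add: vunit_def)
  let ?G = "scaled N d f S"
  have "vunit (eval_form N (d - 1) (pderiv_form a (?G a)) w)" if "a < Suc N" for a
    using diag_pderiv_unit[of N d a "?G a" w] red assms(1,2) cw(2) wV that by simp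
  then have "vunit (\<Prod>a<Suc N. eval_form N (d - 1) (pderiv_form a (?G a)) w)"
    by (intro vunit_prod) simp
  moreover have "jac N d ?G w - (\<Prod>a<Suc N. eval_form N (d - 1) (pderiv_form a (?G a)) w) \<in> mideal"
    using jac_near_diag[OF assms(1) reduces_mem[OF red] red, where w = w and i = 0] wV by simp
  ultimately have "vunit (jac N d ?G w)" by (rule vunit_cong')
  then have "jac N d ?G w \<noteq> 0" by (simp add: vunit_def)
  moreover have "jac N d f y = jac N d f (\<lambda>b. c * (S b * w b))"
    unfolding jac_def using cw(3) by (intro detn_cong eval_form_cong) auto
  then have "jac N d f y = (\<Prod>a<Suc N. c ^ (d - 1)) *
      ((\<Prod>a<Suc N. S a ^ d) * (\<Prod>b<Suc N. inverse (S b)) * jac N d ?G w)"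
    using jac_homogeneous[OF cw(1), of N d f "\<lambda>b. S b * w b"] jac_scaled[of N S d f w] assms(3)
    by (simp del: prod.lessThan_Suc)
  ultimately show ?thesis using cw(1) assms(3) by auto
qed

text \<open>That f carries exact sizes S to S^d is immediate from the reduction. The converse is
  what makes sizes an invariant of the images: only points of sizes S can reach sizes S^d.\<close>

lemma box_eval:
  assumes "d \<ge> 1" "\<And>a. a \<le> N \<Longrightarrow> S a \<noteq> 0"
    and red: "\<And>a. a \<le> N \<Longrightarrow> reduces N d a (scaled N d f S a)"
  shows "eval_map N d f y \<in> box N (\<lambda>b. S b ^ d) \<longleftrightarrow> y \<in> box N S"
proof
  assume "y \<in> box N S"
  then obtain c w where cw: "c \<noteq> 0" "\<And>b. b \<le> N \<Longrightarrow> vunit (w b)" "\<And>b. b \<le> N \<Longrightarrow> y b = c * (S b * w b)"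
    unfolding box_def by blast
  have wV: "w b \<in> V" if "b \<le> N" for b using cw(2) that by (simp add: vunit_def)
  let ?v = "\<lambda>a. eval_form N d (scaled N d f S a) w"
  have "vunit (?v a)" if "a \<le> N" for a
    using vunit_cong'[of "w a ^ d"] reduces_eval[OF red[OF that] that, of w] wV
      vunit_power[OF cw(2)[OF that]] by simp
  moreover have "eval_map N d f y a = c ^ d * (S a ^ d * ?v a)" if "a \<le> N" for a
  proof -
    have "eval_map N d f y a = eval_form N d (f a) (\<lambda>b. c * (S b * w b))"
      using that cw(3) by (auto simp: eval_map_def intro!: eval_form_cong)
    then show ?thesis
      unfolding eval_form_homogeneous[of N d _ c "\<lambda>b. S b * w b"] eval_scaled[of S a N d f w, OF assms(2)[OF that]] .
  qed
  ultimately show "eval_map N d f y \<in> box N (\<lambda>b. S b ^ d)"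
    unfolding box_def using cw(1) by (intro CollectI exI[of _ "c ^ d"] exI[of _ ?v]) auto
next
  assume "eval_map N d f y \<in> box N (\<lambda>b. S b ^ d)"
  then obtain c u where cu: "c \<noteq> 0" "\<And>b. b \<le> N \<Longrightarrow> vunit (u b)"
      "\<And>b. b \<le> N \<Longrightarrow> eval_map N d f y b = c * (S b ^ d * u b)"
    unfolding box_def by blast
  \<comment> \<open>Dividing by the coordinate that is largest relative to S makes \<open>w\<close>
    integral with \<open>w a\<close> = 1. Row \<open>a\<close> then takes a unit value, which shows
    that the scale c / e^d is a unit; so every row takes a unit value, and this value is congruent
    to w_b^d.\<close>
  obtain a where a: "a \<le> N" "\<And>b. b \<le> N \<Longrightarrow> y b / S b \<preceq> y a / S a"
    using vle_max_exists[of "{..N}" "\<lambda>b. y b / S b"] by auto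
  have "y a \<noteq> 0"
  proof
    assume "y a = 0"
    then have "y b = 0" if "b \<le> N" for b
      using a(2)[OF that] assms(2)[OF that] by (auto simp: vle_def)
    then have "eval_form N d (f 0) y = eval_form N d (f 0) (\<lambda>b. 0 * y b)"
      by (intro eval_form_cong) auto
    then have "eval_map N d f y 0 = 0" unfolding eval_form_homogeneous eval_map_def using assms(1) by (simp add: power_0_left)
    then show False using cu(1) cu(2,3)[of 0] assms(2)[of 0] by (simp add: vunit_def)
  qed
  define e where "e = y a / S a"
  have e: "e \<noteq> 0" using \<open>y a \<noteq> 0\<close> assms(2)[OF a(1)] by (simp add: e_def)
  define w where "w b = y b / S b / e" for b
  have yw: "y b = e * (S b * w b)" if "b \<le> N" for b
    using e assms(2)[OF that] by (simp add: w_def)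
  have wV: "w b \<in> V" if "b \<le> N" for b
    unfolding w_def vle_divide_iff[OF e] using a(2)[OF that] by (simp add: e_def)
  have wa: "w a = 1" using e by (simp add: w_def e_def)
  let ?v = "\<lambda>a. eval_form N d (scaled N d f S a) w"
  have ew: "eval_map N d f y b = e ^ d * (S b ^ d * ?v b)" if "b \<le> N" for b
  proof -
    have "eval_map N d f y b = eval_form N d (f b) (\<lambda>b. e * (S b * w b))"
      using that yw by (auto simp: eval_map_def intro!: eval_form_cong)
    then show ?thesis
      unfolding eval_form_homogeneous[of N d _ e "\<lambda>b. S b * w b"] eval_scaled[of S b N d f w, OF assms(2)[OF that]] .
  qed
  have "e ^ d * ?v b = c * u b" if "b \<le> N" for b
  proof -
    have "S b ^ d * (e ^ d * ?v b) = S b ^ d * (c * u b)"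
      using cu(3)[OF that] ew[OF that] by (simp add: mult_ac)
    then show ?thesis using assms(2)[OF that] by simp
  qed
  then have vb: "?v b = (c / e ^ d) * u b" if "b \<le> N" for b
    using that e by (simp add: field_simps)
  have near: "?v b - w b ^ d \<in> mideal" if "b \<le> N" for b
    using reduces_eval[OF red[OF that] that, of w] wV by simp
  have "vunit (?v a)" using near[OF a(1)] wa vunit_cong'[OF one_vunit, of "?v a"] by simp
  moreover have "c / e ^ d = ?v a / u a" using vb[OF a(1)] cu(2)[OF a(1)] by (simp add: vunit_def)
  ultimately have ce: "vunit (c / e ^ d)" using vunit_divide[OF _ cu(2)[OF a(1)], of "?v a"] by simp
  have "vunit (w b)" if "b \<le> N" for b
  proof (rule vunit_mem[OF wV[OF that]])
    have "vunit (?v b)" unfolding vb[OF that] using vunit_mult[OF ce cu(2)[OF that]] .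
    then have "vunit (w b ^ d)" using near[OF that] by (rule vunit_cong)
    then show "w b \<notin> mideal" using mideal_power[of "w b" d] assms(1) vunit_not_mideal by auto
  qed
  then show "y \<in> box N S" unfolding box_def using e yw
    by (intro CollectI exI[of _ e] exI[of _ w]) simp
qed

text \<open>\<open>red\<close> starts at k = 1 because in the application one row does not reduce to
  the power map at the sizes S themselves; that first step is supplied by \<open>x\<close>. Pulling
  back n times from level m > n ends at level m - n \<ge> 1, so level 0 is never reached.\<close>

lemma not_pcf:
  assumes "d \<ge> 1" "vunit (of_nat d)" "\<And>a. a \<le> N \<Longrightarrow> S a \<noteq> 0"
    and red: "\<And>k a. k \<ge> 1 \<Longrightarrow> a \<le> N \<Longrightarrow> reduces N d a (scaled N d f (\<lambda>b. S b ^ d ^ k) a)"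
    and x: "x \<in> ram_locus N d f" "eval_map N d f x \<in> box N (\<lambda>b. S b ^ d)"
  shows "\<not> pcf N d f"
proof -
  define Z where "Z n = (map_image N d f ^^ n) (ram_locus N d f)" for n
  let ?S = "\<lambda>n b. S b ^ d ^ n"
  have Z_Suc: "Z (Suc n) = {(\<lambda>i. c * eval_map N d f x i) | c x. c \<noteq> 0 \<and> x \<in> Z n}" for n
    by (simp add: Z_def map_image_def)
  have step: "eval_map N d f y \<in> box N (?S (Suc n)) \<longleftrightarrow> y \<in> box N (?S n)" if "n \<ge> 1" for y n
  proof -
    have "?S (Suc n) = (\<lambda>b. ?S n b ^ d)" by (simp add: power_mult[symmetric] mult.commute)
    then show ?thesis using box_eval[of d N "?S n" f y] red[OF that] assms(1,3) by simp
  qed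
  have meets: "\<exists>z\<in>Z (Suc n). z \<in> box N (?S (Suc n))" for n
  proof (induction n)
    case 0
    have "eval_map N d f x \<in> Z (Suc 0)"
      unfolding Z_Suc using x(1) by (auto simp: Z_def intro!: exI[of _ 1] exI[of _ x])
    then show ?case using x(2) by auto
  next
    case (Suc n)
    then obtain z where z: "z \<in> Z (Suc n)" "z \<in> box N (?S (Suc n))" by blast
    then have "eval_map N d f z \<in> box N (?S (Suc (Suc n)))" using step[of "Suc n" z] by simp
    moreover have "eval_map N d f z \<in> Z (Suc (Suc n))"
      unfolding Z_Suc[of "Suc n"] using z(1) by (auto intro!: exI[of _ 1] exI[of _ z])
    ultimately show ?case by blast
  qed
  have misses: "z \<notin> box N (?S m)" if "z \<in> Z n" "n < m" for z n m
    using that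
  proof (induction n arbitrary: z m)
    case 0
    then have "z \<in> ram_locus N d f" "m \<ge> 1" by (auto simp: Z_def)
    then show ?case using box_jac[of d N "?S m" f z] red[of m] assms(1-3)
      by (auto simp: ram_locus_jac)
  next
    case (Suc n)
    then obtain c y where y: "c \<noteq> 0" "z = (\<lambda>i. c * eval_map N d f y i)" "y \<in> Z n"
      unfolding Z_Suc by blast
    obtain m' where m: "m = Suc m'" "n < m'" using Suc.prems(2) by (cases m) auto
    show ?case
    proof
      assume "z \<in> box N (?S m)"
      then have "(\<lambda>i. inverse c * z i) \<in> box N (?S m)" using box_scale y(1) by simp
      moreover have "(\<lambda>i. inverse c * z i) = eval_map N d f y" using y by auto
      ultimately have "y \<in> box N (?S m')" using step[of m' y] m by simp
      then show False using Suc.IH[OF y(3) m(2)] by blast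
    qed
  qed
  have neq: "Z a \<noteq> Z b" if ab: "a < b" for a b
  proof
    assume eq: "Z a = Z b"
    obtain n where n: "b = Suc n" using ab by (cases b) auto
    then obtain z where "z \<in> Z b" "z \<in> box N (?S b)" using meets[of n] by blast
    then show False using misses[of z a b] ab eq by blast
  qed
  have "inj Z"
  proof (rule injI)
    fix a b assume "Z a = Z b"
    then show "a = b" using neq[of a b] neq[of b a] by (cases a b rule: linorder_cases) auto
  qed
  then have "infinite (range Z)" by (simp add: finite_image_iff)
  then show ?thesis unfolding pcf_def Z_def .
qed

end

section \<open>A ramification point whose image has exact sizes\<close>

lemma line_poly_axis:
  fixes c :: "'k::field mpoly"
  assumes "i \<le> N"
  shows "line_poly N d c (u(i := 0)) (\<lambda>b. if b = i then 1 else 0)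
    = (\<Sum>m\<in>mons_deg N d. monom (c m * (\<Prod>b\<in>{..N} - {i}. u b ^ m b)) (m i))"
  unfolding line_poly_def eval_form_def
proof (rule sum.cong[OF refl])
  fix m assume "m \<in> mons_deg N d"
  let ?X = "\<lambda>b. [:(u(i := 0)) b, if b = i then 1 else 0:]"
  have const: "(\<Prod>b\<in>A. [:g b:]) = [:\<Prod>b\<in>A. g b:]" for A :: "nat set" and g :: "nat \<Rightarrow> 'k"
    by (induction A rule: infinite_finite_induct) (auto simp: one_pCons)
  have "(\<Prod>b\<le>N. ?X b ^ m b) = ?X i ^ m i * (\<Prod>b\<in>{..N} - {i}. ?X b ^ m b)"
    using assms by (intro prod.remove) auto
  also have "?X i ^ m i = monom 1 (m i)" by (simp add: monom_altdef)
  also have "(\<Prod>b\<in>{..N} - {i}. ?X b ^ m b) = (\<Prod>b\<in>{..N} - {i}. [:u b ^ m b:])"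
    by (intro prod.cong) (auto simp: poly_const_pow)
  also have "\<dots> = [:\<Prod>b\<in>{..N} - {i}. u b ^ m b:]" by (rule const)
  finally show "[:c m:] * (\<Prod>b\<le>N. ?X b ^ m b) = monom (c m * (\<Prod>b\<in>{..N} - {i}. u b ^ m b)) (m i)"
    by (simp add: smult_monom mult_ac)
qed

context valuation_ring
begin

text \<open>All coordinates but x_i are frozen at generic units, leaving the polynomial
  \<open>p\<close> in x_i. Modulo \<open>mideal\<close> the Jacobian on that line is a unit times
  the derivative of \<open>p\<close>, so a critical point of \<open>p\<close> over the residue field
  is an approximate zero of the Jacobian, and \<open>root_near\<close> moves it to an exact zero
  without changing residues.\<close>

lemma critical_point_exists:
  assumes ac: "alg_closed TYPE('k)" and d: "d \<ge> 2"
    and units: "\<And>j. 0 < j \<Longrightarrow> j \<le> d \<Longrightarrow> vunit (of_nat j)"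
    and i: "i \<le> N"
    and red: "\<And>a. a \<le> N \<Longrightarrow> a \<noteq> i \<Longrightarrow> reduces N d a (G a)"
    and Gi: "\<And>m. m \<in> mons_deg N d \<Longrightarrow> G i m \<in> V" "G i (mono_pow i d) = 1"
      "\<And>m. m \<in> mons_deg N d \<Longrightarrow> m i = d - 1 \<Longrightarrow> G i m = 0"
    and \<mu>: "\<mu> \<in> mons_deg N d" "\<mu> \<noteq> mono_pow i d" "vunit (G i \<mu>)"
  shows "\<exists>w. (\<forall>b\<le>N. w b \<in> V) \<and> (\<forall>b\<le>N. b \<noteq> i \<longrightarrow> vunit (w b)) \<and>
    jac N d G w = 0 \<and> vunit (eval_form N d (G i) w)"
proof -
  have GV: "G a m \<in> V" if "a \<le> N" "m \<in> mons_deg N d" for a m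
    using that Gi(1) reduces_mem[OF red[of a], of m] by (cases "a = i") auto
  \<comment> \<open>The monomials with the same power of x_i as \<mu>. Their sum at \<open>u\<close>
    is, up to a power of the unit \<open>u i\<close>, the coefficient of \<open>p\<close> at
    \<open>\<mu> i\<close>; for a generic choice of \<open>u\<close> it is a unit.\<close>
  define M where "M = {m \<in> mons_deg N d. m i = \<mu> i}"
  have M: "finite M" "\<mu> \<in> M" using finite_mons_deg[of N d] \<mu>(1) by (auto simp: M_def)
  have "\<exists>u. (\<forall>b. vunit (u b)) \<and> vunit (\<Sum>m\<in>M. G i m * (\<Prod>b\<le>N. u b ^ m b))"
    using M(1) _ _ M(2) \<mu>(3)
    by (rule generic_units[OF ac]) (auto simp: M_def mons_deg_def intro: Gi(1))
  then obtain u where u: "\<And>b. vunit (u b)" "vunit (\<Sum>m\<in>M. G i m * (\<Prod>b\<le>N. u b ^ m b))" by blast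
  define e :: "nat \<Rightarrow> 'k" where "e = (\<lambda>b. if b = i then 1 else 0)"
  define w where "w \<xi> = u(i := \<xi>)" for \<xi>
  have line: "(\<lambda>b. (u(i := 0)) b + \<xi> * e b) = w \<xi>" for \<xi> by (auto simp: e_def w_def)
  have wV: "w \<xi> b \<in> V" if "\<xi> \<in> V" for \<xi> b using that u(1)[of b] by (simp add: w_def vunit_def)
  define p where "p = line_poly N d (G i) (u(i := 0)) e"
  have pe: "poly p \<xi> = eval_form N d (G i) (w \<xi>)" for \<xi>
    unfolding p_def poly_line_poly line ..
  have pd: "poly (pderiv p) \<xi> = eval_form N (d - 1) (pderiv_form i (G i)) (w \<xi>)" for \<xi>
  proof -
    have "poly (pderiv p) \<xi> = (\<Sum>b\<le>N. e b * eval_form N (d - 1) (pderiv_form b (G i)) (w \<xi>))"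
      unfolding p_def using poly_pderiv_line_poly[of d N "G i" "u(i := 0)" e \<xi>] d unfolding line by simp
    also have "\<dots> = (\<Sum>b\<le>N. if b = i then eval_form N (d - 1) (pderiv_form i (G i)) (w \<xi>) else 0)"
      by (intro sum.cong) (auto simp: e_def)
    finally show ?thesis using i by simp
  qed
  let ?c = "\<lambda>m. G i m * (\<Prod>b\<in>{..N} - {i}. u b ^ m b)"
  have pc: "coeff p l = (\<Sum>m\<in>mons_deg N d. if m i = l then ?c m else 0)" for l
    unfolding p_def e_def line_poly_axis[OF i] coeff_sum coeff_monom ..
  have uV: "(\<Prod>b\<in>{..N} - {i}. u b ^ m b) \<in> V" for m
    using u(1) by (intro prod_mem power_mem) (simp add: vunit_def)
  have vp: "integral_poly p" unfolding integral_poly_def pc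
    using Gi(1) uV by (auto intro!: sum_mem mult_mem simp: zero_mem)
  have full: "m = mono_pow i d" if "m \<in> mons_deg N d" "m i = d" for m
    using mons_deg_full i that by blast
  have "coeff p d = (\<Sum>m\<in>mons_deg N d. if m = mono_pow i d then 1 else 0)"
    unfolding pc
  proof (rule sum.cong[OF refl])
    fix m assume m: "m \<in> mons_deg N d"
    have "?c (mono_pow i d) = 1" using Gi(2) by (simp add: mono_pow_def)
    moreover have "m i = d \<longleftrightarrow> m = mono_pow i d" using full[OF m] by (auto simp: mono_pow_def)
    ultimately show "(if m i = d then ?c m else 0) = (if m = mono_pow i d then 1 else 0)" by auto
  qed
  then have cd: "coeff p d = 1" using finite_mons_deg mono_pow_mons_deg[OF i] by simp
  have "coeff p l = 0" if "l > d" for l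
    unfolding pc using that by (intro sum.neutral) (auto dest!: mons_deg_le[where b = i])
  then have dp: "degree p = d" using cd by (intro antisym degree_le le_degree) auto
  have cd1: "coeff p (d - 1) = 0" unfolding pc using Gi(3) by (intro sum.neutral) auto
  have "\<mu> i \<noteq> d" using full \<mu>(1,2) by blast
  then have \<mu>d: "\<mu> i < d" using mons_deg_le[OF \<mu>(1), of i] by simp
  have "vunit (coeff p (\<mu> i))"
  proof -
    have "coeff p (\<mu> i) = (\<Sum>m\<in>M. ?c m)"
      unfolding pc M_def using finite_mons_deg by (simp add: sum.inter_filter)
    moreover have "(\<Sum>m\<in>M. G i m * (\<Prod>b\<le>N. u b ^ m b)) = u i ^ \<mu> i * (\<Sum>m\<in>M. ?c m)"
      unfolding sum_distrib_left
    proof (rule sum.cong[OF refl])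
      fix m assume "m \<in> M"
      then have "m i = \<mu> i" by (simp add: M_def)
      moreover have "(\<Prod>b\<le>N. u b ^ m b) = u i ^ m i * (\<Prod>b\<in>{..N} - {i}. u b ^ m b)"
        using i by (intro prod.remove) auto
      ultimately show "G i m * (\<Prod>b\<le>N. u b ^ m b) = u i ^ \<mu> i * ?c m" by simp
    qed
    ultimately have "coeff p (\<mu> i) = (\<Sum>m\<in>M. G i m * (\<Prod>b\<le>N. u b ^ m b)) / u i ^ \<mu> i"
      using u(1)[of i] by (simp add: vunit_def)
    then show ?thesis using vunit_divide[OF u(2) vunit_power[OF u(1)]] by simp
  qed
  then obtain \<eta> where \<eta>: "\<eta> \<in> V" "vunit (poly p \<eta>)" "poly (pderiv p) \<eta> \<in> mideal"
    using critical_point_unit_value[OF ac dp d _ units vp cd1 \<mu>d] cd dp by auto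
  define h where "h = detn (Suc N) (\<lambda>a b. line_poly N (d - 1) (pderiv_form b (G a)) (u(i := 0)) e)"
  have he: "poly h \<xi> = jac N d G (w \<xi>)" for \<xi>
    unfolding h_def poly_detn poly_line_poly line jac_def ..
  have hm: "poly h \<xi> \<in> mideal \<longleftrightarrow> poly (pderiv p) \<xi> \<in> mideal" if \<xi>: "\<xi> \<in> V" for \<xi>
  proof -
    let ?D = "\<lambda>a. eval_form N (d - 1) (pderiv_form a (G a)) (w \<xi>)"
    have "vunit (?D a)" if "a < Suc N" "a \<noteq> i" for a
      using diag_pderiv_unit[of N d a "G a" "w \<xi>"] red[of a] d that wV[OF \<xi>] u(1) units[of d]
      by (simp add: w_def)
    then have U: "vunit (\<Prod>a\<in>{..<Suc N} - {i}. ?D a)" by (intro vunit_prod) auto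
    have "(\<Prod>a<Suc N. ?D a) = ?D i * (\<Prod>a\<in>{..<Suc N} - {i}. ?D a)"
      using i by (intro prod.remove) auto
    then have "(\<Prod>a<Suc N. ?D a) = (\<Prod>a\<in>{..<Suc N} - {i}. ?D a) * poly (pderiv p) \<xi>"
      using pd by simp
    then have near: "poly h \<xi> - (\<Prod>a\<in>{..<Suc N} - {i}. ?D a) * poly (pderiv p) \<xi> \<in> mideal"
      using jac_near_diag[of d N G i "w \<xi>"] d GV red wV[OF \<xi>] he[of \<xi>] by simp
    show ?thesis
    proof
      assume "poly h \<xi> \<in> mideal"
      from mideal_diff[OF this near] have "(\<Prod>a\<in>{..<Suc N} - {i}. ?D a) * poly (pderiv p) \<xi> \<in> mideal"
        by simp
      then show "poly (pderiv p) \<xi> \<in> mideal" using vunit_mult_mideal[OF U] by blast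
    next
      assume "poly (pderiv p) \<xi> \<in> mideal"
      then have "(\<Prod>a\<in>{..<Suc N} - {i}. ?D a) * poly (pderiv p) \<xi> \<in> mideal"
        using U by (intro mideal_mult') (simp_all add: vunit_def)
      from mideal_add[OF near this] show "poly h \<xi> \<in> mideal" by simp
    qed
  qed
  \<comment> \<open>\<open>root_near\<close> also needs a point where \<open>h\<close> is not small.
    The derivative of \<open>p\<close> has the unit d as a coefficient, so it takes a unit value
    somewhere.\<close>
  have "coeff (pderiv p) (d - 1) = of_nat d" using d cd by (simp add: coeff_pderiv flip: of_nat_Suc)
  then obtain w0 where w0: "vunit w0" "vunit (poly (pderiv p) w0)"
    using unit_value[OF ac integral_poly_pderiv[OF vp], of "d - 1"] units[of d] d by auto
  have w0V: "w0 \<in> V" using w0(1) by (simp add: vunit_def)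
  have "poly h w0 \<notin> mideal" using hm[OF w0V] vunit_not_mideal[OF w0(2)] by blast
  moreover have "poly h \<eta> \<in> mideal" using hm[OF \<eta>(1)] \<eta>(3) by blast
  ultimately obtain \<xi> where \<xi>: "poly h \<xi> = 0" "\<xi> - \<eta> \<in> mideal"
    using root_near[OF ac \<eta>(1) w0V] by blast
  have \<xi>V: "\<xi> \<in> V" using add_mem[OF mideal_mem[OF \<xi>(2)] \<eta>(1)] by simp
  have "vunit (poly p \<xi>)" using vunit_cong'[OF \<eta>(2) poly_cong_arg[OF vp \<xi>V \<eta>(1) \<xi>(2)]] .
  then show ?thesis using \<xi>(1) wV[OF \<xi>V] u(1) unfolding he pe
    by (intro exI[of _ "w \<xi>"]) (auto simp: w_def)
qed

section \<open>The choice of scales\<close>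

theorem pcf_coeffs_mem:
  assumes ac: "alg_closed TYPE('k)" and d: "d \<ge> 2"
    and units: "\<And>j. 0 < j \<Longrightarrow> j \<le> d \<Longrightarrow> vunit (of_nat j)"
    and f: "monic_poly N d f"
    and centered: "\<And>i. i < N \<Longrightarrow> f i ((mono_pow i (d - 1))(N := 1)) = 0"
    and pcf: "pcf N d f" and a0: "a0 \<le> N"
  shows "f a0 m0 \<in> V"
proof (rule ccontr)
  assume notin: "f a0 m0 \<notin> V"
  have hom: "m \<in> mons_deg N d" if "f a m \<noteq> 0" "a \<le> N" for a m
    using f that unfolding monic_poly_def homogeneous_def by blast
  have fN: "f N m = (if m = mono_pow N d then 1 else 0)" for m
    using f unfolding monic_poly_def by blast
  have f0: "f a m = (if m = mono_pow a d then 1 else 0)" if "a < N" "m N = 0" for a m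
    using f that unfolding monic_poly_def by blast
  have f1: "f a (mono_pow a d) = 1" if "a \<le> N" for a
    using that fN f0[of a "mono_pow a d"] by (cases "a = N") (auto simp: mono_pow_def)
  \<comment> \<open>Apart from the terms x_a^d, only monomials divisible by x_N occur in a monic map
    (\<open>nz\<close>). This makes \<open>m N\<close> usable as the exponent of the root
    \<open>\<rho>\<close> below and gives \<open>m i\<close> < d.\<close>
  define M where "M = {m \<in> mons_deg N d. m N \<ge> 1}"
  have finM: "finite M" using finite_mons_deg by (simp add: M_def)
  have nz: "a < N \<and> m \<in> M" if "f a m \<noteq> 0" "m \<noteq> mono_pow a d" "a \<le> N" for a m
    using that fN[of m] f0[of a m] hom[of a m] by (cases "a = N"; cases "m N = 0") (auto simp: M_def)
  have "f a0 m0 \<noteq> 0" "m0 \<noteq> mono_pow a0 d" using notin f1[OF a0] zero_mem one_mem by metis+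
  then have "a0 < N \<and> m0 \<in> M" using nz a0 by blast
  define I where "I = {..<N} \<times> M"
  have I: "finite I" "(a0, m0) \<in> I" using finM \<open>a0 < N \<and> m0 \<in> M\<close> by (auto simp: I_def)
  have "\<forall>p\<in>I. \<exists>x. x ^ snd p N = f (fst p) (snd p)"
    using alg_closed_nth_root[OF ac] by (auto simp: I_def M_def)
  then obtain \<rho> where \<rho>: "\<And>p. p \<in> I \<Longrightarrow> \<rho> p ^ snd p N = f (fst p) (snd p)" by metis
  have "I \<noteq> {}" using I(2) by blast
  then obtain p where p: "p \<in> I" "\<forall>b\<in>I. \<rho> b \<preceq> \<rho> p" using vle_max_exists[OF I(1)] by blast
  obtain i \<mu> where i\<mu>: "p = (i, \<mu>)" by (cases p)
  have i: "i < N" and \<mu>: "\<mu> \<in> M" using p(1) by (auto simp: i\<mu> I_def)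
  \<comment> \<open>The maximum r of the overview is |\<rho> p|. The further d-th root makes the
    size r^(1 + 1/d) available, namely that of \<open>\<sigma>\<close>.\<close>
  obtain q where q: "q ^ d = \<rho> p" using alg_closed_nth_root[OF ac, of d] d by auto
  have fb: "f a m \<preceq> q ^ (d * m N)" if "a < N" "m \<in> M" for a m
  proof -
    have am: "(a, m) \<in> I" using that by (simp add: I_def)
    have "f a m = \<rho> (a, m) ^ m N" using \<rho>[OF am] by simp
    then show ?thesis using vle_power p(2) am by (simp add: power_mult q)
  qed
  have f\<mu>: "f i \<mu> = q ^ (d * \<mu> N)"
    using \<rho>[OF p(1)] by (simp add: power_mult q i\<mu>)
  have q1: "1 \<prec> q"
  proof (rule ccontr)
    assume "\<not> 1 \<prec> q"
    then have "q ^ (d * m0 N) \<preceq> 1" using vle_power[of q 1] by (simp add: vlt_def)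
    then have "f a0 m0 \<preceq> 1" using fb[of a0 m0] \<open>a0 < N \<and> m0 \<in> M\<close> vle_trans by blast
    then show False using notin vle_one_iff by blast
  qed
  have q0: "q \<noteq> 0" using vlt_nonzero[OF q1] .
  note qle = vle_power_mono[OF vlt_imp_vle[OF q1]]
  note qlt = vlt_power_mono[OF q1]
  have mi: "m i + m N + (\<Sum>b\<in>{..N} - {N} - {i}. m b) = d" if "m \<in> mons_deg N d" for m
  proof -
    have "(\<Sum>b\<le>N. m b) = m N + (m i + (\<Sum>b\<in>{..N} - {N} - {i}. m b))"
      using i by (subst sum.remove[of _ N], simp, simp, subst sum.remove[of _ i]) auto
    then show ?thesis using that by (simp add: mons_deg_def)
  qed
  \<comment> \<open>The size must exceed r = |q|^d, so that the rows other than i reduce to the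
    power map already at \<open>S\<close>. It must exceed it by little, so that |\<sigma>|^n < r^(n
    + m_N) with n = \<open>n m\<close>, the degree in the coordinates other than x_i and x_N: this
    means n < d m_N, which holds since n < d.\<close>
  define \<sigma> where "\<sigma> = q ^ (d + 1)"
  define n where "n m = d - m N - m i" for m
  have n: "n m + m N + m i = d" if "m \<in> mons_deg N d" for m using mi[OF that] by (simp add: n_def)
  have MD: "m \<in> mons_deg N d" "m N \<ge> 1" "m i < d" "d - m i = n m + m N" if "m \<in> M" for m
    using that n[of m] by (auto simp: M_def)
  \<comment> \<open>\<open>\<theta> m\<close> is the size of x_i at which the term \<open>m\<close>
    ties with x_i^d when x_N has size 1 and the other coordinates have size |\<sigma>|. The largest
    of these is the last size at which a tie occurs, a slope of the Newton polygon in x_i.\<close>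
  have "\<forall>m\<in>M. \<exists>x. x ^ (d - m i) = f i m * \<sigma> ^ n m"
    using alg_closed_nth_root[OF ac] MD(3) by simp
  then obtain \<theta> where \<theta>: "\<And>m. m \<in> M \<Longrightarrow> \<theta> m ^ (d - m i) = f i m * \<sigma> ^ n m" by metis
  obtain \<nu> where \<nu>: "\<nu> \<in> M" "\<forall>m\<in>M. \<theta> m \<preceq> \<theta> \<nu>" using vle_max_exists[OF finM, of \<theta>] \<mu> by blast
  define \<tau> where "\<tau> = \<theta> \<nu>"
  have \<tau>b: "f i m * \<sigma> ^ n m \<preceq> \<tau> ^ (d - m i)" if "m \<in> M" for m
    unfolding \<theta>[OF that, symmetric] \<tau>_def using \<nu>(2) that by (intro vle_power) blast
  \<comment> \<open>The coefficient of \<mu> attains the bound r^(m_N), and |\<sigma>| \<ge> r, so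
    already the tie of \<mu> occurs at a size of at least r.\<close>
  have q\<tau>: "q ^ d \<preceq> \<tau>"
  proof -
    have "(q ^ d) ^ (d - \<mu> i) = q ^ (d * n \<mu> + d * \<mu> N)"
      using MD(4)[OF \<mu>] by (simp add: distrib_left flip: power_mult)
    also have "\<dots> \<preceq> q ^ (d * \<mu> N + (d + 1) * n \<mu>)" by (rule qle) simp
    also have "\<dots> = \<theta> \<mu> ^ (d - \<mu> i)"
      unfolding \<theta>[OF \<mu>] f\<mu> \<sigma>_def by (simp only: power_add power_mult)
    finally have "q ^ d \<preceq> \<theta> \<mu>" using vle_power_iff[of "d - \<mu> i" "q ^ d" "\<theta> \<mu>"] MD(3)[OF \<mu>] by simp
    then show ?thesis using \<nu>(2) \<mu> vle_trans unfolding \<tau>_def by blast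
  qed
  have \<tau>0: "\<tau> \<noteq> 0"
  proof
    assume "\<tau> = 0"
    then show False using q\<tau> zero_vlt[of "q ^ d"] q0 by (simp add: vlt_def)
  qed
  \<comment> \<open>All coefficients are bounded by r^(m_N) with r \<le> |\<sigma>|, so no tie
    occurs beyond |\<sigma>|. This lets x_i be bounded like the other coordinates in the rows a
    \<noteq> i.\<close>
  have \<tau>\<sigma>: "\<tau> \<preceq> \<sigma>"
  proof -
    have "\<tau> ^ (d - \<nu> i) = f i \<nu> * \<sigma> ^ n \<nu>" using \<theta>[OF \<nu>(1)] by (simp add: \<tau>_def)
    also have "\<dots> \<preceq> q ^ (d * \<nu> N) * \<sigma> ^ n \<nu>" using fb[OF i \<nu>(1)] vle_mult vle_refl by blast
    also have "\<dots> = q ^ (d * \<nu> N + (d + 1) * n \<nu>)" unfolding \<sigma>_def by (simp only: power_add power_mult)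
    also have "\<dots> \<preceq> q ^ ((d + 1) * (d - \<nu> i))"
      unfolding MD(4)[OF \<nu>(1)] by (rule qle) (simp add: algebra_simps)
    also have "\<dots> = \<sigma> ^ (d - \<nu> i)" unfolding \<sigma>_def by (simp only: power_mult)
    finally show ?thesis using vle_power_iff[of "d - \<nu> i" \<tau> \<sigma>] MD(3)[OF \<nu>(1)] by simp
  qed
  have \<sigma>0: "\<sigma> \<noteq> 0" using q0 by (simp add: \<sigma>_def)
  define S where "S b = (if b = N then 1 else if b = i then \<tau> else \<sigma>)" for b
  have S0: "S b \<noteq> 0" for b using \<tau>0 \<sigma>0 by (simp add: S_def)
  define Y where "Y m = \<sigma> ^ n m * \<tau> ^ m i" for m
  have Y: "(\<Prod>b\<le>N. S b ^ m b) = Y m" if "m \<in> mons_deg N d" for m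
  proof -
    have "(\<Prod>b\<le>N. S b ^ m b) = S N ^ m N * (S i ^ m i * (\<Prod>b\<in>{..N} - {N} - {i}. S b ^ m b))"
      using i by (subst prod.remove[of _ N], simp, simp, subst prod.remove[of _ i]) auto
    also have "(\<Prod>b\<in>{..N} - {N} - {i}. S b ^ m b) = \<sigma> ^ (\<Sum>b\<in>{..N} - {N} - {i}. m b)"
      unfolding power_sum by (intro prod.cong) (auto simp: S_def)
    also have "(\<Sum>b\<in>{..N} - {N} - {i}. m b) = n m" using mi[OF that] by (simp add: n_def)
    finally show ?thesis using i by (simp add: S_def Y_def)
  qed
  \<comment> \<open>The monomial without its coefficient is strictly smaller than x_i^d; this is
    what turns a tie at \<open>S\<close> into a strict inequality at the higher powers of
    \<open>S\<close>.\<close>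
  have Y\<tau>: "Y m \<prec> \<tau> ^ d" if m: "m \<in> M" for m
  proof -
    have e: "(d + 1) * n m < d * (d - m i)"
    proof -
      have "n m < d" using MD(2)[OF m] n[OF MD(1)[OF m]] by simp
      also have "d \<le> d * m N" using MD(2)[OF m] by simp
      finally show ?thesis unfolding MD(4)[OF m] by (simp add: algebra_simps)
    qed
    have "\<sigma> ^ n m = q ^ ((d + 1) * n m)" unfolding \<sigma>_def by (simp only: power_mult)
    also have "\<dots> \<prec> q ^ (d * (d - m i))" using qlt e by blast
    also have "\<dots> = (q ^ d) ^ (d - m i)" by (simp only: power_mult)
    also have "\<dots> \<preceq> \<tau> ^ (d - m i)" using q\<tau> by (rule vle_power)
    finally have "\<sigma> ^ n m * \<tau> ^ m i \<prec> \<tau> ^ (d - m i) * \<tau> ^ m i"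
      using vlt_cancel[of "\<tau> ^ m i"] \<tau>0 by simp
    then show ?thesis using MD(3)[OF m] by (simp add: Y_def flip: power_add)
  qed
  have fY: "f i m * Y m \<preceq> \<tau> ^ d" if m: "m \<in> M" for m
  proof -
    have "f i m * \<sigma> ^ n m * \<tau> ^ m i \<preceq> \<tau> ^ (d - m i) * \<tau> ^ m i"
      using \<tau>b[OF m] by (intro vle_mult vle_refl)
    then show ?thesis using MD(3)[OF m] by (simp add: Y_def mult.assoc flip: power_add)
  qed
  have small: "f a m * Y m ^ d ^ k \<prec> (S a ^ d ^ k) ^ d"
    if am: "a \<le> N" "m \<noteq> mono_pow a d" and ak: "a \<noteq> i \<or> k \<ge> 1" for a m k
  proof (cases "f a m = 0")
    case True
    then show ?thesis using zero_vlt S0 by simp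
  next
    case False
    then have a: "a < N" and m: "m \<in> M" using nz am by blast+
    show ?thesis
    proof (cases "a = i")
      case ai: True
      \<comment> \<open>One factor \<open>Y m\<close> absorbs the coefficient, and each of the
        \<open>l\<close> others is strictly below \<tau>^d. For k = 0 none is left over, which is
        why row i needs k \<ge> 1.\<close>
      define l where "l = d ^ k - 1"
      have "d ^ 1 \<le> d ^ k" using ak ai d by (intro power_increasing) auto
      then have l: "d ^ k = Suc l" "l > 0" using d by (auto simp: l_def)
      have "(f i m * Y m) * Y m ^ l \<prec> \<tau> ^ d * (\<tau> ^ d) ^ l"
        using vle_vlt_mult[OF fY[OF m] vlt_power[OF Y\<tau>[OF m] l(2)]] \<tau>0 by simp
      moreover have "(\<tau> ^ Suc l) ^ d = \<tau> ^ d * (\<tau> ^ d) ^ l"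
        by (simp add: power_mult_distrib flip: power_mult) (simp add: mult.commute)
      ultimately show ?thesis using ai i l(1) by (simp add: S_def mult.assoc)
    next
      case False
      have "Y m \<preceq> \<sigma> ^ n m * \<sigma> ^ m i" unfolding Y_def using vle_power[OF \<tau>\<sigma>] vle_mult vle_refl by blast
      also have "\<dots> = q ^ ((d + 1) * (n m + m i))" unfolding \<sigma>_def by (simp only: power_add power_mult)
      finally have "Y m ^ d ^ k \<preceq> (q ^ ((d + 1) * (n m + m i))) ^ d ^ k" by (rule vle_power)
      then have "f a m * Y m ^ d ^ k \<preceq> q ^ (d * m N) * (q ^ ((d + 1) * (n m + m i))) ^ d ^ k"
        using fb[OF a m] vle_mult by blast
      also have "\<dots> = q ^ (d * m N + (d + 1) * (n m + m i) * d ^ k)" by (simp only: power_add power_mult)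
      also have "\<dots> \<prec> q ^ ((d + 1) * d ^ k * (n m + m N + m i))"
      proof (rule qlt)
        have "d * m N < (d + 1) * m N" using MD(2)[OF m] by simp
        also have "\<dots> \<le> (d + 1) * m N * d ^ k" using d by simp
        finally show "d * m N + (d + 1) * (n m + m i) * d ^ k < (d + 1) * d ^ k * (n m + m N + m i)"
          by (simp add: algebra_simps)
      qed
      also have "\<dots> = (\<sigma> ^ d ^ k) ^ d" unfolding n[OF MD(1)[OF m]] \<sigma>_def by (simp only: power_mult)
      finally show ?thesis using False a by (simp add: S_def)
    qed
  qed
  have wk: "(\<Prod>b\<le>N. (S b ^ d ^ k) ^ m b) = Y m ^ d ^ k" if "m \<in> mons_deg N d" for m k
    unfolding Y[OF that, symmetric] prod_power_distrib by (simp add: mult.commute flip: power_mult)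
  have red: "reduces N d a (scaled N d f (\<lambda>b. S b ^ d ^ k) a)" if "a \<le> N" "a \<noteq> i \<or> k \<ge> 1" for a k
    unfolding reduces_def
  proof (intro conjI ballI impI)
    show "scaled N d f (\<lambda>b. S b ^ d ^ k) a (mono_pow a d) = 1"
      unfolding scaled_def prod_mono_pow[OF that(1)] using f1[OF that(1)] S0 by simp
    fix m assume m: "m \<in> mons_deg N d" "m \<noteq> mono_pow a d"
    show "scaled N d f (\<lambda>b. S b ^ d ^ k) a m \<in> mideal"
      unfolding scaled_def wk[OF m(1)] using small[OF that(1) m(2) that(2)] S0
      by (subst mideal_divide_iff) auto
  qed
  define G where "G = scaled N d f S"
  have G1: "G i (mono_pow i d) = 1"
    unfolding G_def scaled_def prod_mono_pow[OF less_imp_le[OF i]] using f1 i S0 by simp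
  have GV: "G i m \<in> V" if m: "m \<in> mons_deg N d" for m
  proof (cases "m = mono_pow i d \<or> f i m = 0")
    case True
    then show ?thesis using G1 one_mem zero_mem by (auto simp: G_def scaled_def)
  next
    case False
    then have "m \<in> M" using nz[of i m] i by simp
    then show ?thesis unfolding G_def scaled_def Y[OF m]
      using fY i \<tau>0 by (subst vle_divide_iff) (auto simp: S_def)
  qed
  \<comment> \<open>A monomial of degree d divisible by x_N with exponent d - 1 at x_i can only be
    x_i^(d-1) x_N, whose coefficient vanishes by \<open>centered\<close>.\<close>
  have Gc: "G i m = 0" if m: "m \<in> mons_deg N d" "m i = d - 1" for m
  proof (rule ccontr)
    assume "G i m \<noteq> 0"
    then have fm: "f i m \<noteq> 0" by (auto simp: G_def scaled_def)
    have "m \<noteq> mono_pow i d" using m(2) d by (auto simp: mono_pow_def)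
    then have "m \<in> M" using nz[of i m] fm i by simp
    then have mN: "m N = 1" and s: "(\<Sum>b\<in>{..N} - {N} - {i}. m b) = 0"
      using MD(2)[of m] mi[OF m(1)] m(2) d by linarith+
    have "m b = 0" if "b \<in> {..N} - {N} - {i}" for b
      using s that by simp
    then have "m b = ((mono_pow i (d - 1))(N := 1)) b" for b
      using m i mN by (cases "b \<le> N") (auto simp: mono_pow_def mons_deg_def)
    then have "m = (mono_pow i (d - 1))(N := 1)" by (rule ext)
    then show False using centered[OF i] fm by simp
  qed
  \<comment> \<open>The tie that defines \<tau>: after scaling, the coefficient at \<nu> is exactly
    1, so row i keeps a lower term over the residue field.\<close>
  have "f i \<nu> * Y \<nu> = \<tau> ^ d"
    unfolding Y_def \<tau>_def mult.assoc[symmetric] \<theta>[OF \<nu>(1), symmetric]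
    using MD(3)[OF \<nu>(1)] by (simp flip: power_add)
  then have G\<nu>: "vunit (G i \<nu>)"
    unfolding G_def scaled_def Y[OF MD(1)[OF \<nu>(1)]] using i \<tau>0 one_vunit by (simp add: S_def)
  have \<nu>i: "\<nu> \<noteq> mono_pow i d" using MD(2)[OF \<nu>(1)] i by (auto simp: mono_pow_def)
  have redG: "reduces N d a (G a)" if "a \<le> N" "a \<noteq> i" for a
    using red[OF that(1), of 0] that(2) by (simp add: G_def)
  obtain w where w: "\<And>b. b \<le> N \<Longrightarrow> w b \<in> V" "\<And>b. b \<le> N \<Longrightarrow> b \<noteq> i \<Longrightarrow> vunit (w b)"
      "jac N d G w = 0" "vunit (eval_form N d (G i) w)"
    using critical_point_exists[OF ac d units less_imp_le[OF i] redG GV G1 Gc MD(1)[OF \<nu>(1)] \<nu>i G\<nu>] by blast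
  define x where "x b = (if b \<le> N then S b * w b else 0)" for b
  have "jac N d f x = jac N d f (\<lambda>b. S b * w b)"
    unfolding jac_def by (intro detn_cong eval_form_cong) (simp add: x_def)
  then have "jac N d f x = 0" using jac_scaled[of N S d f w] S0 w(3) by (simp add: G_def)
  moreover have "x N \<noteq> 0" using w(2)[of N] S0 i by (simp add: x_def vunit_def)
  ultimately have xR: "x \<in> ram_locus N d f"
    by (auto simp: ram_locus_jac pts_def vecs_def x_def fun_eq_iff)
  have "vunit (eval_form N d (G a) w)" if a: "a \<le> N" for a
  proof (cases "a = i")
    case False
    then show ?thesis
      using vunit_cong'[OF vunit_power[OF w(2)[OF a False]]] reduces_eval[OF redG[OF a False] a, of w] w(1)
      by simp
  qed (use w(4) in simp)
  moreover have "eval_map N d f x a = 1 * (S a ^ d * eval_form N d (G a) w)" if "a \<le> N" for a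
  proof -
    have "eval_map N d f x a = eval_form N d (f a) (\<lambda>b. S b * w b)"
      using that by (auto simp: eval_map_def x_def intro!: eval_form_cong)
    then show ?thesis using eval_scaled[of S a N d f w] S0 by (simp add: G_def)
  qed
  ultimately have "eval_map N d f x \<in> box N (\<lambda>b. S b ^ d)"
    unfolding box_def
    by (intro CollectI exI[of _ 1] exI[of _ "\<lambda>a. eval_form N d (G a) w"]) simp
  then have "\<not> pcf N d f"
    using not_pcf[of d N S f x] d units[of d] S0 red xR by simp
  then show False using pcf by blast
qed

end

section \<open>Valuation rings avoiding a transcendental element\<close>

definition is_subring :: "'k::field set \<Rightarrow> bool" where
  "is_subring A \<longleftrightarrow> 1 \<in> A \<and> (\<forall>x\<in>A. \<forall>y\<in>A. x - y \<in> A \<and> x * y \<in> A)"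

lemma is_subringD:
  assumes "is_subring A"
  shows "1 \<in> A" "0 \<in> A" "x \<in> A \<Longrightarrow> - x \<in> A"
    "x \<in> A \<Longrightarrow> y \<in> A \<Longrightarrow> x + y \<in> A" "x \<in> A \<Longrightarrow> y \<in> A \<Longrightarrow> x - y \<in> A"
    "x \<in> A \<Longrightarrow> y \<in> A \<Longrightarrow> x * y \<in> A"
proof -
  have d: "x - y \<in> A" if "x \<in> A" "y \<in> A" for x y using assms that by (simp add: is_subring_def)
  show one: "1 \<in> A" using assms by (simp add: is_subring_def)
  then show zero: "0 \<in> A" using d[OF one one] by simp
  have m: "- x \<in> A" if "x \<in> A" for x using d[OF zero that] by simp
  show "x \<in> A \<Longrightarrow> - x \<in> A" by (rule m)
  show "x \<in> A \<Longrightarrow> y \<in> A \<Longrightarrow> x - y \<in> A" by (rule d)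
  show "x \<in> A \<Longrightarrow> y \<in> A \<Longrightarrow> x + y \<in> A" using d[of x "- y"] m[of y] by simp
  show "x \<in> A \<Longrightarrow> y \<in> A \<Longrightarrow> x * y \<in> A" using assms by (simp add: is_subring_def)
qed

lemma is_subring_sum:
  "is_subring A \<Longrightarrow> (\<And>i. i \<in> I \<Longrightarrow> g i \<in> A) \<Longrightarrow> sum g I \<in> A"
  by (induction I rule: infinite_finite_induct) (auto intro: is_subringD)

definition polys_over :: "'k::field set \<Rightarrow> 'k poly set" where
  "polys_over A = {p. \<forall>l. coeff p l \<in> A}"

definition adjoin :: "'k::field set \<Rightarrow> 'k \<Rightarrow> 'k set" where
  "adjoin A x = (\<lambda>p. poly p x) ` polys_over A"

lemma adjoin_superset:
  assumes "is_subring A"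
  shows "A \<subseteq> adjoin A x" "x \<in> adjoin A x"
proof
  fix a assume "a \<in> A"
  then have "[:a:] \<in> polys_over A" using is_subringD(2)[OF assms]
    by (auto simp: polys_over_def coeff_pCons split: nat.split)
  then show "a \<in> adjoin A x" unfolding adjoin_def by (intro image_eqI[of _ _ "[:a:]"]) auto
next
  have "[:0, 1:] \<in> polys_over A" using is_subringD(1,2)[OF assms]
    by (auto simp: polys_over_def coeff_pCons split: nat.split)
  then show "x \<in> adjoin A x" unfolding adjoin_def by (intro image_eqI[of _ _ "[:0, 1:]"]) auto
qed

lemma is_subring_adjoin:
  assumes "is_subring A"
  shows "is_subring (adjoin A x)"
  unfolding is_subring_def
proof (intro conjI ballI)
  show "1 \<in> adjoin A x" using adjoin_superset(1)[OF assms] is_subringD(1)[OF assms] by blast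
  fix y z assume "y \<in> adjoin A x" "z \<in> adjoin A x"
  then obtain p q where pq: "p \<in> polys_over A" "q \<in> polys_over A" "y = poly p x" "z = poly q x"
    by (auto simp: adjoin_def)
  have "p - q \<in> polys_over A" using pq(1,2) is_subringD(5)[OF assms] by (simp add: polys_over_def)
  then show "y - z \<in> adjoin A x" unfolding adjoin_def pq by (intro image_eqI[of _ _ "p - q"]) auto
  have "p * q \<in> polys_over A" using pq(1,2)[unfolded polys_over_def]
    by (auto simp: polys_over_def coeff_mult intro!: is_subring_sum[OF assms] is_subringD(6)[OF assms])
  then show "y * z \<in> adjoin A x" unfolding adjoin_def pq by (intro image_eqI[of _ _ "p * q"]) auto
qed

text \<open>One step of the elimination in Chevalley's extension theorem: relations of degree n for x
  and for its inverse, with coefficients in the ideal J, give a relation of lower degree for x.\<close>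

lemma chevalley_step:
  fixes x :: "'k::field"
  assumes A: "is_subring A" and J: "J \<subseteq> A" "\<And>a b. a \<in> J \<Longrightarrow> b \<in> J \<Longrightarrow> a + b \<in> J"
      "\<And>a b. a \<in> A \<Longrightarrow> b \<in> J \<Longrightarrow> a * b \<in> J" "0 \<in> J"
    and "x \<noteq> 0" "n > 0"
    and a: "\<And>i. a i \<in> J" "(\<Sum>i\<le>n. a i * x ^ i) = 1"
    and b: "\<And>i. b i \<in> J" "(\<Sum>i\<le>n. b i * inverse x ^ i) = 1"
  shows "\<exists>c. (\<forall>i. c i \<in> J) \<and> (\<Sum>i\<le>n - 1. c i * x ^ i) = 1"
proof -
  \<comment> \<open>Multiplying the relation \<open>b\<close> by x^n expresses (1 - b_0) x^n through
    lower powers. Multiplying the relation \<open>a\<close> by 1 - b_0 and substituting this for its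
    top term yields \<open>?c\<close>.\<close>
  let ?c = "\<lambda>i. (if i = 0 then b 0 else 0) + (1 - b 0) * a i + a n * b (n - i)"
  have "(\<Sum>i\<le>n. b (n - i) * x ^ i) = (\<Sum>i\<le>n. b i * x ^ (n - i))"
    by (rule sum.reindex_bij_witness[of _ "\<lambda>i. n - i" "\<lambda>i. n - i"]) auto
  also have "\<dots> = x ^ n * (\<Sum>i\<le>n. b i * inverse x ^ i)"
    unfolding sum_distrib_left using \<open>x \<noteq> 0\<close>
    by (intro sum.cong) (auto simp: power_diff field_simps)
  finally have "(\<Sum>i\<le>n. b (n - i) * x ^ i) = x ^ n" using b(2) by simp
  moreover have split: "(\<Sum>i\<le>n. h i) = (\<Sum>i\<le>n - 1. h i) + h n" for h :: "nat \<Rightarrow> 'k"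
    using \<open>n > 0\<close> by (cases n) auto
  ultimately have B: "(\<Sum>i\<le>n - 1. b (n - i) * x ^ i) = x ^ n - b 0 * x ^ n"
    by (simp add: eq_diff_eq)
  have C: "(\<Sum>i\<le>n - 1. a i * x ^ i) = 1 - a n * x ^ n"
    using a(2) unfolding split by (simp add: eq_diff_eq)
  have "(\<Sum>i\<le>n - 1. ?c i * x ^ i) = (\<Sum>i\<le>n - 1. (if i = 0 then b 0 else 0) * x ^ i)
      + (1 - b 0) * (\<Sum>i\<le>n - 1. a i * x ^ i) + a n * (\<Sum>i\<le>n - 1. b (n - i) * x ^ i)"
    by (simp add: distrib_right sum.distrib sum_distrib_left mult.assoc)
  also have "(\<Sum>i\<le>n - 1. (if i = 0 then b 0 else 0) * x ^ i) = (\<Sum>i\<le>n - 1. if i = 0 then b 0 else 0)"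
    by (intro sum.cong) auto
  also have "\<dots> = b 0" by simp
  finally have "(\<Sum>i\<le>n - 1. ?c i * x ^ i) = 1" unfolding B C by (simp add: algebra_simps)
  moreover have "?c i \<in> J" for i
  proof -
    have "b 0 \<in> A" "a n \<in> A" using a(1) b(1) J(1) by auto
    then have "1 - b 0 \<in> A" using is_subringD(1,5)[OF A] by blast
    then have "(1 - b 0) * a i \<in> J" "a n * b (n - i) \<in> J"
      using J(3) a(1) b(1) \<open>a n \<in> A\<close> by blast+
    moreover have "(if i = 0 then b 0 else 0) \<in> J" using b(1) J(4) by simp
    ultimately show ?thesis using J(2) by blast
  qed
  ultimately show ?thesis by (intro exI[of _ ?c]) blast
qed

text \<open>If x and its inverse were both outside \<open>A\<close>, maximality would put
  \<open>c\<close> into both adjoined rings. Dividing by \<open>c\<close> turns this into relations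
  for 1 with coefficients in the ideal generated by \<open>inverse c\<close>, and relations of least
  degree contradict \<open>chevalley_step\<close>.\<close>

lemma maximal_subring_valuation:
  fixes c :: "'k::field"
  assumes A: "is_subring A" "inverse c \<in> A" "c \<notin> A"
    and max: "\<And>B. is_subring B \<Longrightarrow> A \<subseteq> B \<Longrightarrow> c \<notin> B \<Longrightarrow> B = A"
  shows "valuation_ring A"
proof
  show "1 \<in> A" using is_subringD(1)[OF A(1)] .
  show "x + y \<in> A" "x * y \<in> A" if "x \<in> A" "y \<in> A" for x y
    using is_subringD(4,6)[OF A(1)] that by auto
  show "- x \<in> A" if "x \<in> A" for x using is_subringD(3)[OF A(1)] that by auto
  fix x show "x \<in> A \<or> inverse x \<in> A"
  proof (rule ccontr)
    assume "\<not> (x \<in> A \<or> inverse x \<in> A)"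
    then have x: "x \<notin> A" "inverse x \<notin> A" by auto
    have x0: "x \<noteq> 0" using x is_subringD(2)[OF A(1)] by auto
    have c0: "c \<noteq> 0" using A(3) is_subringD(2)[OF A(1)] by auto
    \<comment> \<open>This principal ideal is proper since \<open>c\<close> is outside
      \<open>A\<close>; it takes the place of the maximal ideal in the usual form of the
      argument.\<close>
    define J where "J = (*) (inverse c) ` A"
    have J: "J \<subseteq> A" "\<And>a b. a \<in> J \<Longrightarrow> b \<in> J \<Longrightarrow> a + b \<in> J"
      "\<And>a b. a \<in> A \<Longrightarrow> b \<in> J \<Longrightarrow> a * b \<in> J" "0 \<in> J"
    proof -
      show "J \<subseteq> A" using A is_subringD(6)[OF A(1)] by (auto simp: J_def)
      show "a + b \<in> J" if "a \<in> J" "b \<in> J" for a b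
        using that is_subringD(4)[OF A(1)] by (auto simp: J_def simp flip: distrib_left)
      show "a * b \<in> J" if "a \<in> A" "b \<in> J" for a b
        using that is_subringD(6)[OF A(1)] unfolding J_def by (auto simp: mult.left_commute)
      show "0 \<in> J" using is_subringD(2)[OF A(1)] by (auto simp: J_def intro!: image_eqI[of _ _ 0])
    qed
    have oneJ: "1 \<notin> J"
    proof
      assume "1 \<in> J"
      then obtain a where "a \<in> A" "1 = inverse c * a" by (auto simp: J_def)
      then have "a = c" using c0 by (simp add: field_simps)
      then show False using A(3) \<open>a \<in> A\<close> by simp
    qed
    define R where "R y n \<longleftrightarrow> (\<exists>a. (\<forall>i. a i \<in> J) \<and> (\<Sum>i\<le>n. a i * y ^ i) = 1)" for y n
    have R0: "\<not> R y 0" for y using oneJ by (auto simp: R_def) (metis oneJ)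
    have Rmono: "R y n" if Rm: "R y m" "m \<le> n" for y m n
    proof -
      obtain a where a: "\<And>i. a i \<in> J" "(\<Sum>i\<le>m. a i * y ^ i) = 1" using Rm(1) by (auto simp: R_def)
      have "(\<Sum>i\<le>n. (if i \<le> m then a i else 0) * y ^ i) = (\<Sum>i\<le>m. a i * y ^ i)"
        using Rm(2) by (intro sum.mono_neutral_cong_right) auto
      then show ?thesis unfolding R_def using a J(4)
        by (intro exI[of _ "\<lambda>i. if i \<le> m then a i else 0"]) auto
    qed
    have Rex: "\<exists>n. R y n" if y: "y \<notin> A" for y
    proof -
      have "c \<in> adjoin A y"
        using max[OF is_subring_adjoin[OF A(1)] adjoin_superset(1)[OF A(1)], of y]
          adjoin_superset(2)[OF A(1), of y] y by blast
      then obtain p where p: "p \<in> polys_over A" "c = poly p y" by (auto simp: adjoin_def)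
      have "(\<Sum>i\<le>degree p. (inverse c * coeff p i) * y ^ i) = inverse c * poly p y"
        by (simp add: poly_altdef sum_distrib_left mult.assoc)
      then have "(\<Sum>i\<le>degree p. (inverse c * coeff p i) * y ^ i) = 1" using p(2) c0 by simp
      moreover have "inverse c * coeff p i \<in> J" for i using p(1) by (auto simp: J_def polys_over_def)
      ultimately show ?thesis unfolding R_def
        by (intro exI[of _ "degree p"] exI[of _ "\<lambda>i. inverse c * coeff p i"]) auto
    qed
    have step: "R y (n - 1)" if "R y n" "R (inverse y) n" "y \<noteq> 0" for y n
    proof -
      have "n > 0" using that(1) R0[of y] by (cases n) auto
      then show ?thesis using that chevalley_step[OF A(1) J \<open>y \<noteq> 0\<close>] unfolding R_def by blast
    qed
    define n where "n = (LEAST n. R x n)"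
    define m where "m = (LEAST n. R (inverse x) n)"
    have Rn: "R x n" unfolding n_def using Rex[OF x(1)] by (rule LeastI_ex)
    have Rm: "R (inverse x) m" unfolding m_def using Rex[OF x(2)] by (rule LeastI_ex)
    have n0: "n > 0" "m > 0" using Rn Rm R0 by (auto intro!: gr0I)
    \<comment> \<open>The shorter relation is padded with zeros to the length of the longer one, and
      the elimination then shortens the longer one below its minimum.\<close>
    show False
    proof (cases "m \<le> n")
      case True
      then have "R x (n - 1)" using step[OF Rn Rmono[OF Rm]] x0 by blast
      then have "n \<le> n - 1" unfolding n_def by (rule Least_le)
      then show False using n0 by simp
    next
      case False
      then have "R (inverse x) (m - 1)" using step[OF Rm] Rmono[OF Rn, of m] x0 by simp
      then have "m \<le> m - 1" unfolding m_def by (rule Least_le)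
      then show False using n0 by simp
    qed
  qed
qed

lemma valuation_ring_avoiding:
  fixes c :: "'k::field"
  assumes A: "is_subring A" "inverse c \<in> A" "c \<notin> A"
  shows "\<exists>V. valuation_ring V \<and> A \<subseteq> V \<and> c \<notin> V"
proof -
  define \<A> where "\<A> = {B. is_subring B \<and> A \<subseteq> B \<and> c \<notin> B}"
  have "\<exists>M\<in>\<A>. \<forall>X\<in>\<A>. M \<subseteq> X \<longrightarrow> X = M"
  proof (rule subset_Zorn_nonempty)
    show "\<A> \<noteq> {}" using A by (auto simp: \<A>_def)
    fix C assume C: "C \<noteq> {}" "subset.chain \<A> C"
    have CA: "is_subring B" "A \<subseteq> B" "c \<notin> B" if "B \<in> C" for B
      using C(2) that by (auto simp: \<A>_def subset_chain_def)
    have "is_subring (\<Union>C)" unfolding is_subring_def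
    proof (intro conjI ballI)
      show "1 \<in> \<Union>C" using C(1) CA(1) is_subringD(1) by blast
      fix x y assume "x \<in> \<Union>C" "y \<in> \<Union>C"
      then obtain X Y where XY: "X \<in> C" "x \<in> X" "Y \<in> C" "y \<in> Y" by blast
      then have "X \<subseteq> Y \<or> Y \<subseteq> X" using C(2) by (auto simp: subset_chain_def)
      then obtain Z where Z: "Z \<in> C" "x \<in> Z" "y \<in> Z" using XY by blast
      then show "x - y \<in> \<Union>C" "x * y \<in> \<Union>C"
        using is_subringD(5,6)[OF CA(1)[OF Z(1)] Z(2,3)] by blast+
    qed
    then show "\<Union>C \<in> \<A>" using C(1) CA(2,3) by (auto simp: \<A>_def)
  qed
  then obtain M where M: "M \<in> \<A>" "\<And>X. X \<in> \<A> \<Longrightarrow> M \<subseteq> X \<Longrightarrow> X = M" by blast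
  have "valuation_ring M"
  proof (rule maximal_subring_valuation)
    show "is_subring M" "inverse c \<in> M" "c \<notin> M" using M(1) A(2) by (auto simp: \<A>_def)
    show "B = M" if "is_subring B" "M \<subseteq> B" "c \<notin> B" for B
      using that M by (auto simp: \<A>_def)
  qed
  then show ?thesis using M(1) by (auto simp: \<A>_def)
qed

section \<open>The prime field and its algebraic elements\<close>

definition prime_field :: "'k::field set" where
  "prime_field = {of_int a / of_int b | a b. of_int b \<noteq> (0 :: 'k)}"

lemma is_subring_prime_field: "is_subring (prime_field :: 'k::field set)"
  unfolding is_subring_def
proof (intro conjI ballI)
  show "1 \<in> (prime_field :: 'k set)"
    unfolding prime_field_def by (intro CollectI exI[of _ 1]) auto
  fix x y :: 'k assume "x \<in> prime_field" "y \<in> prime_field"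
  then obtain a b a' b' where *: "x = of_int a / of_int b" "y = of_int a' / of_int b'"
      "of_int b \<noteq> (0 :: 'k)" "of_int b' \<noteq> (0 :: 'k)"
    by (auto simp: prime_field_def)
  then show "x - y \<in> prime_field" unfolding prime_field_def
    by (intro CollectI exI[of _ "a * b' - a' * b"] exI[of _ "b * b'"]) (simp add: diff_frac_eq)
  show "x * y \<in> prime_field" unfolding prime_field_def using *
    by (intro CollectI exI[of _ "a * a'"] exI[of _ "b * b'"]) simp
qed

text \<open>Serves to make 1, ..., d units in every valuation ring that contains the prime field, so
  that reduction keeps them nonzero.\<close>

lemma inverse_of_nat_prime_field:
  "of_nat j \<noteq> (0 :: 'k::field) \<Longrightarrow> inverse (of_nat j :: 'k) \<in> prime_field"
  unfolding prime_field_def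
  by (intro CollectI exI[of _ 1] exI[of _ "int j"]) (simp add: inverse_eq_divide)

lemma countable_prime_field: "countable (prime_field :: 'k::field set)"
proof -
  have "prime_field \<subseteq> (\<lambda>(a, b). of_int a / of_int b :: 'k) ` UNIV" by (auto simp: prime_field_def)
  then show ?thesis by (rule countable_subset) auto
qed

text \<open>Evaluating at the inverse changes nothing, since an element and its inverse are algebraic
  simultaneously, and it fits the adjunction of the inverse of c below.\<close>

definition algebraic_elements :: "'k::field set" where
  "algebraic_elements = {c. \<exists>p \<in> polys_over prime_field. p \<noteq> 0 \<and> poly p (inverse c) = 0}"

lemma countable_algebraic_elements: "countable (algebraic_elements :: 'k::field set)"
proof -
  have "polys_over prime_field \<subseteq> (Poly ` lists prime_field :: 'k poly set)"
  proof
    fix p :: "'k poly" assume "p \<in> polys_over prime_field"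
    then have "coeffs p \<in> lists prime_field"
      by (auto simp: polys_over_def coeffs_def)
    then show "p \<in> Poly ` lists prime_field" by (intro image_eqI[of _ _ "coeffs p"]) auto
  qed
  then have "countable (polys_over prime_field :: 'k poly set)"
    by (rule countable_subset) (intro countable_image countable_lists countable_prime_field)
  then have "countable (polys_over prime_field - {0 :: 'k poly})"
    by (rule countable_subset[OF Diff_subset])
  then have "countable (\<Union>p\<in>polys_over prime_field - {0 :: 'k poly}. {x. poly p x = 0})"
    by (rule countable_UN) (auto intro: countable_finite poly_roots_finite)
  moreover have "algebraic_elements \<subseteq>
      inverse ` (\<Union>p\<in>polys_over prime_field - {0 :: 'k poly}. {x. poly p x = 0})"
  proof
    fix c :: 'k assume "c \<in> algebraic_elements"
    then show "c \<in> inverse ` (\<Union>p\<in>polys_over prime_field - {0}. {x. poly p x = 0})"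
      by (intro image_eqI[of _ _ "inverse c"]) (auto simp: algebraic_elements_def)
  qed
  ultimately show ?thesis by (rule countable_subset[OF _ countable_image, rotated])
qed

lemma zero_algebraic: "0 \<in> algebraic_elements"
proof -
  have "[:0, 1:] \<in> polys_over prime_field" using is_subringD(1,2)[OF is_subring_prime_field]
    by (auto simp: polys_over_def coeff_pCons split: nat.split)
  then show ?thesis unfolding algebraic_elements_def by (auto intro!: bexI[of _ "[:0, 1:]"])
qed

text \<open>If \<open>c\<close> were a polynomial p in its inverse, the inverse would be a zero of X
  p(X) - 1, which is nonzero because of its constant term. Hence the ring adjoining
  \<open>inverse c\<close> misses \<open>c\<close>.\<close>

lemma transcendental_valuation_ring:
  fixes c :: "'k::field"
  assumes "c \<notin> algebraic_elements"
  shows "\<exists>V. valuation_ring V \<and> prime_field \<subseteq> V \<and> c \<notin> V"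
proof -
  let ?A = "adjoin prime_field (inverse c)"
  have "c \<noteq> 0" using assms zero_algebraic by auto
  have "c \<notin> ?A"
  proof
    assume "c \<in> ?A"
    then obtain p where p: "p \<in> polys_over prime_field" "c = poly p (inverse c)"
      by (auto simp: adjoin_def)
    have "pCons (- 1) p \<in> polys_over prime_field"
      using p(1) is_subringD(1,3)[OF is_subring_prime_field]
      by (auto simp: polys_over_def coeff_pCons split: nat.split)
    moreover have "poly (pCons (- 1) p) (inverse c) = 0" using p(2) \<open>c \<noteq> 0\<close> by (simp flip: p(2))
    ultimately have "c \<in> algebraic_elements" unfolding algebraic_elements_def
      by (intro CollectI bexI[of _ "pCons (- 1) p"]) auto
    then show False using assms by blast
  qed
  then obtain V where "valuation_ring V" "?A \<subseteq> V" "c \<notin> V"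
    using valuation_ring_avoiding[OF is_subring_adjoin[OF is_subring_prime_field]]
      adjoin_superset(2)[OF is_subring_prime_field] by blast
  then show ?thesis using adjoin_superset(1)[OF is_subring_prime_field] by blast
qed

section \<open>Translation to centered form\<close>

text \<open>The coefficients of a translated form are never expanded. Closure properties of the
  functions given by forms show that the translate is a form, and values determine coefficients by
  \<open>form_unique\<close>.\<close>

definition form_fun :: "nat \<Rightarrow> nat \<Rightarrow> ((nat \<Rightarrow> 'k::field) \<Rightarrow> 'k) \<Rightarrow> bool" where
  "form_fun N e F \<longleftrightarrow> (\<exists>c. \<forall>x. eval_form N e c x = F x)"

lemma form_fun_add: "form_fun N e F \<Longrightarrow> form_fun N e G \<Longrightarrow> form_fun N e (\<lambda>x. F x + G x)"
  unfolding form_fun_def by (metis eval_form_add)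

lemma form_fun_smult: "form_fun N e F \<Longrightarrow> form_fun N e (\<lambda>x. a * F x)"
  unfolding form_fun_def by (metis eval_form_smult)

lemma form_fun_sum: "(\<And>i. i \<in> I \<Longrightarrow> form_fun N e (F i)) \<Longrightarrow> form_fun N e (\<lambda>x. \<Sum>i\<in>I. F i x)"
proof (induction I rule: infinite_finite_induct)
  case (insert i I)
  then show ?case using form_fun_add[of N e "F i" "\<lambda>x. \<Sum>i\<in>I. F i x"] by simp
qed (auto simp: form_fun_def eval_form_def intro!: exI[of _ "\<lambda>_. 0"])

lemma form_fun_one: "form_fun N 0 (\<lambda>x. 1)"
  unfolding form_fun_def
  using eval_form_mono_pow[of 0 N 0 "\<lambda>m. if m = mono_pow 0 0 then 1 else 0"] by force

lemma form_fun_coord: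
  assumes "form_fun N e F" "b \<le> N"
  shows "form_fun N (Suc e) (\<lambda>x. x b * F x)"
proof -
  obtain c where c: "\<And>x. eval_form N e c x = F x" using assms(1) by (auto simp: form_fun_def)
  let ?c = "\<lambda>m. if m b > 0 then c (m(b := m b - 1)) else 0"
  have "eval_form N (Suc e) ?c x = x b * F x" for x
  proof -
    have "eval_form N (Suc e) ?c x = (\<Sum>m\<in>{m\<in>mons_deg N (Suc e). m b > 0}. ?c m * (\<Prod>i\<le>N. x i ^ m i))"
      unfolding eval_form_def using finite_mons_deg by (intro sum.mono_neutral_right) auto
    also have "\<dots> = (\<Sum>m\<in>mons_deg N e. x b * (c m * (\<Prod>i\<le>N. x i ^ m i)))"
    proof (rule sum.reindex_bij_witness[where j = "\<lambda>m. m(b := m b - 1)" and i = "\<lambda>m. m(b := m b + 1)"])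
      fix m assume "m \<in> {m\<in>mons_deg N (Suc e). m b > 0}"
      then have m: "m \<in> mons_deg N (Suc e)" "m b > 0" by auto
      show "(m(b := m b - 1))(b := (m(b := m b - 1)) b + 1) = m" using m by auto
      have "(\<Sum>i\<le>N. m i) = m b + (\<Sum>i\<in>{..N} - {b}. m i)"
        using assms by (intro sum.remove) auto
      moreover have "(\<Sum>i\<le>N. (m(b := m b - 1)) i) = (m b - 1) + (\<Sum>i\<in>{..N} - {b}. m i)"
        using assms by (subst sum.remove[of _ b]) auto
      ultimately show "m(b := m b - 1) \<in> mons_deg N e"
        using m assms by (auto simp: mons_deg_def)
      have "(\<Prod>a\<le>N. x a ^ (m(b := m b - 1)) a) = x b ^ (m b - 1) * (\<Prod>a\<in>{..N} - {b}. x a ^ m a)"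
        using assms by (subst prod.remove[of _ b]) auto
      moreover have "(\<Prod>a\<le>N. x a ^ m a) = x b ^ m b * (\<Prod>a\<in>{..N} - {b}. x a ^ m a)"
        using assms by (intro prod.remove) auto
      moreover have "x b ^ m b = x b * x b ^ (m b - 1)" using m(2) by (cases "m b") auto
      ultimately show "x b * (c (m(b := m b - 1)) * (\<Prod>i\<le>N. x i ^ (m(b := m b - 1)) i))
          = ?c m * (\<Prod>i\<le>N. x i ^ m i)"
        using m by (simp add: mult_ac)
    next
      fix m assume m: "m \<in> mons_deg N e"
      show "(m(b := m b + 1))(b := (m(b := m b + 1)) b - 1) = m" by auto
      have "(\<Sum>i\<le>N. m i) = m b + (\<Sum>i\<in>{..N} - {b}. m i)"
        using assms by (intro sum.remove) auto
      moreover have "(\<Sum>i\<le>N. (m(b := m b + 1)) i) = (m b + 1) + (\<Sum>i\<in>{..N} - {b}. m i)"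
        using assms by (subst sum.remove[of _ b]) auto
      ultimately show "m(b := m b + 1) \<in> {m\<in>mons_deg N (Suc e). m b > 0}"
        using m assms by (auto simp: mons_deg_def)
    qed
    finally show ?thesis by (simp add: c[symmetric] eval_form_def sum_distrib_left)
  qed
  then show ?thesis unfolding form_fun_def by blast
qed

text \<open>In affine coordinates (the last coordinate being 1), shift N c is the translation by c.\<close>

definition shift :: "nat \<Rightarrow> (nat \<Rightarrow> 'k::field) \<Rightarrow> (nat \<Rightarrow> 'k) \<Rightarrow> nat \<Rightarrow> 'k" where
  "shift N c x = (\<lambda>b. if b < N then x b + c b * x N else x b)"

definition coord_vec :: "nat \<Rightarrow> nat \<Rightarrow> 'k::field" where
  "coord_vec j = (\<lambda>b. if b = j then 1 else 0)"

lemma shift_shift [simp]: "shift N (\<lambda>b. - c b) (shift N c x) = x" "shift N c (shift N (\<lambda>b. - c b) x) = x"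
  by (auto simp: shift_def)

lemma shift_line: "shift N c (\<lambda>b. x b + t * v b) = (\<lambda>b. shift N c x b + t * shift N c v b)"
  by (auto simp: shift_def algebra_simps)

lemma shift_smult: "shift N c (\<lambda>b. t * v b) = (\<lambda>b. t * shift N c v b)"
  by (auto simp: shift_def algebra_simps)

lemma shift_pts:
  assumes "x \<in> pts N"
  shows "shift N c x \<in> pts N"
proof -
  have "shift N c x \<in> vecs N" using assms by (auto simp: pts_def vecs_def shift_def)
  moreover have "shift N c x \<noteq> (\<lambda>_. 0)"
  proof
    assume "shift N c x = (\<lambda>_. 0)"
    then have "x = shift N (\<lambda>b. - c b) (\<lambda>_. 0)" by (metis shift_shift(1))
    then have "x = (\<lambda>_. 0)" by (simp add: shift_def fun_eq_iff)
    then show False using assms by (simp add: pts_def)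
  qed
  ultimately show ?thesis by (simp add: pts_def)
qed

text \<open>Each monomial is built up one factor at a time: a coordinate of the shifted point is a
  linear form, so multiplying by it raises the degree by one.\<close>

lemma form_fun_shift:
  fixes f :: "'k::field mpoly"
  shows "form_fun N e (\<lambda>x. eval_form N e f (shift N c x))"
proof -
  have lin: "form_fun N (Suc e) (\<lambda>x. shift N c x b * F x)"
    if F: "form_fun N e F" and b: "b \<le> N" for F :: "(nat \<Rightarrow> 'k) \<Rightarrow> 'k" and b e
  proof (cases "b < N")
    case True
    then show ?thesis
      using form_fun_add[OF form_fun_coord[OF F b] form_fun_smult[OF form_fun_coord[OF F order.refl], of "c b"]]
      by (simp add: shift_def distrib_right mult.assoc)
  next
    case False
    then show ?thesis using form_fun_coord[OF F b] by (simp add: shift_def)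
  qed
  have pow: "form_fun N (n + e) (\<lambda>x. shift N c x b ^ n * F x)"
    if "form_fun N e F" "b \<le> N" for F :: "(nat \<Rightarrow> 'k) \<Rightarrow> 'k" and b e n
    using lin[of "n + e" _ b for n] that by (induction n) (auto simp: mult.assoc)
  have "form_fun N (\<Sum>b\<in>B. m b) (\<lambda>x. \<Prod>b\<in>B. shift N c x b ^ m b)"
    if "finite B" "B \<subseteq> {..N}" for B m
    using that
  proof (induction rule: finite_induct)
    case empty
    then show ?case using form_fun_one by simp
  next
    case (insert b B)
    then show ?case using pow[of "\<Sum>b\<in>B. m b" _ b "m b"] by simp
  qed
  from this[of "{..N}"] have "form_fun N e (\<lambda>x. \<Prod>b\<le>N. shift N c x b ^ m b)"
    if "m \<in> mons_deg N e" for m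
    using that unfolding mons_deg_def by fastforce
  then show ?thesis unfolding eval_form_def by (intro form_fun_sum form_fun_smult)
qed

lemma form_fun_homogeneous:
  assumes "form_fun N e F"
  shows "\<exists>c. homogeneous N e c \<and> (\<forall>x. eval_form N e c x = F x)"
proof -
  obtain c where c: "\<And>x. eval_form N e c x = F x" using assms by (auto simp: form_fun_def)
  have "eval_form N e (\<lambda>m. if m \<in> mons_deg N e then c m else 0) x = F x" for x
    unfolding c[symmetric] eval_form_def by (intro sum.cong) auto
  then show ?thesis
    by (intro exI[of _ "\<lambda>m. if m \<in> mons_deg N e then c m else 0"]) (simp add: homogeneous_def)
qed

lemma form_unique:
  fixes c :: "'k::field mpoly"
  assumes "alg_closed TYPE('k)" "homogeneous N e c" "homogeneous N e c'"
    "\<And>x. eval_form N e c x = eval_form N e c' x"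
  shows "c = c'"
proof
  fix m
  show "c m = c' m"
  proof (cases "m \<in> mons_deg N e")
    case True
    have "eval_form N e (\<lambda>m. c m + (- 1) * c' m) x = 0" for x
      unfolding eval_form_add eval_form_smult using assms(4) by simp
    from form_coeff_zero[OF assms(1) this True] show ?thesis by simp
  next
    case False
    then show ?thesis using assms(2,3) by (metis homogeneous_def)
  qed
qed

text \<open>Otherwise p - q is a nonconstant polynomial that vanishes everywhere, and p - q + 1 is a
  nonconstant one without zeros.\<close>

lemma alg_closed_poly_eqI:
  fixes p q :: "'k::field poly"
  assumes "alg_closed TYPE('k)" "\<And>t. poly p t = poly q t"
  shows "p = q"
proof (rule ccontr)
  assume "p \<noteq> q"
  define r where "r = p - q"
  have r: "r \<noteq> 0" "\<And>t. poly r t = 0" using \<open>p \<noteq> q\<close> assms(2) by (auto simp: r_def)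
  have "degree r \<noteq> 0"
  proof
    assume "degree r = 0"
    then obtain a where "r = [:a:]" by (metis degree_eq_zeroE)
    then show False using r by auto
  qed
  then have "degree (r + 1) \<ge> 1" by (simp add: degree_add_eq_left)
  then obtain t where "poly (r + 1) t = 0" using alg_closed_root[OF assms(1)] by blast
  then show False using r(2) by simp
qed

lemma eval_form_coord_vec:
  assumes "i \<le> N"
  shows "eval_form N e c (coord_vec i) = (c (mono_pow i e) :: 'k::field)"
proof -
  have "c m * (\<Prod>b\<le>N. coord_vec i b ^ m b) = (if m = mono_pow i e then c m else 0)"
    if m: "m \<in> mons_deg N e" for m
  proof (cases "m = mono_pow i e")
    case True
    then show ?thesis using assms by (simp add: prod_mono_pow coord_vec_def)
  next
    case False
    then have "m i \<noteq> e" using mons_deg_full m assms by blast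
    have "\<exists>b\<in>{..N} - {i}. m b \<noteq> 0"
    proof (rule ccontr)
      assume "\<not> ?thesis"
      then have "(\<Sum>b\<in>{..N} - {i}. m b) = 0" by simp
      then have "(\<Sum>b\<le>N. m b) = m i" using assms by (subst sum.remove[of _ i]) auto
      then show False using m \<open>m i \<noteq> e\<close> by (simp add: mons_deg_def)
    qed
    then obtain b where "b \<in> {..N}" "b \<noteq> i" "m b \<noteq> 0" by blast
    then have "\<exists>b\<in>{..N}. coord_vec i b ^ m b = (0 :: 'k)"
      by (intro bexI[of _ b]) (auto simp: coord_vec_def power_0_left)
    then have "(\<Prod>b\<le>N. coord_vec i b ^ m b) = (0 :: 'k)" by (intro prod_zero) auto
    then show ?thesis using False by simp
  qed
  then have "eval_form N e c (coord_vec i) = (\<Sum>m\<in>mons_deg N e. if m = mono_pow i e then c m else 0)"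
    unfolding eval_form_def by (intro sum.cong) auto
  then show ?thesis using finite_mons_deg mono_pow_mons_deg[OF assms] by simp
qed

lemma eval_form_zero_coord:
  "eval_form N e c (x(N := 0)) = eval_form N e (\<lambda>m. if m N = 0 then c m else 0) x"
  unfolding eval_form_def
proof (rule sum.cong[OF refl])
  fix m
  have "(\<Prod>b\<le>N. (x(N := 0)) b ^ m b) = 0 ^ m N * (\<Prod>b\<in>{..N} - {N}. x b ^ m b)"
    by (subst prod.remove[of _ N]) auto
  moreover have "(\<Prod>b\<le>N. x b ^ m b) = x N ^ m N * (\<Prod>b\<in>{..N} - {N}. x b ^ m b)"
    by (intro prod.remove) auto
  ultimately show "c m * (\<Prod>b\<le>N. (x(N := 0)) b ^ m b) = (if m N = 0 then c m else 0) * (\<Prod>b\<le>N. x b ^ m b)"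
    by (cases "m N = 0") (auto simp: power_0_left)
qed

lemma detn_shift: "detn (Suc N) (\<lambda>b j. shift N c (coord_vec j) b) = 1"
proof -
  let ?A = "mat (Suc N) (Suc N) (\<lambda>(b, j). shift N c (coord_vec j) b)"
  have "det ?A = prod_list (diag_mat ?A)"
    by (rule det_upper_triangular[of _ "Suc N"]) (auto simp: shift_def coord_vec_def)
  also have "diag_mat ?A = map (\<lambda>_. 1) [0..<Suc N]"
    unfolding diag_mat_def by (intro map_cong) (auto simp: shift_def coord_vec_def)
  also have "prod_list \<dots> = 1" by (simp add: map_replicate_const)
  finally show ?thesis by (simp add: detn_det)
qed

lemma shift_expand:
  assumes "b \<le> N"
  shows "shift N c y b = (\<Sum>a\<le>N. shift N c (coord_vec a) b * y a)"
proof -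
  have "(\<Sum>a\<le>N. shift N c (coord_vec a) b * y a)
      = (\<Sum>a\<le>N. (if a = b then y a else 0) + (if a = N then (if b < N then c b * y a else 0) else 0))"
    by (intro sum.cong) (auto simp: shift_def coord_vec_def)
  also have "\<dots> = y b + (if b < N then c b * y N else 0)"
    using assms by (simp add: sum.distrib)
  finally show ?thesis by (simp add: shift_def)
qed

section \<open>Conjugation by a translation\<close>

locale shifted_map =
  fixes N d :: nat and f g :: "nat \<Rightarrow> 'k::field mpoly" and c :: "nat \<Rightarrow> 'k"
  assumes alg_closed: "alg_closed TYPE('k)" and d: "d \<ge> 2"
    and eval_shifted: "eval_map N d g x = shift N (\<lambda>b. - c b) (eval_map N d f (shift N c x))"
begin

lemma eval_component:
  assumes "i \<le> N"
  shows "eval_form N d (g i) x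
    = (\<Sum>a\<le>N. shift N (\<lambda>b. - c b) (coord_vec a) i * eval_form N d (f a) (shift N c x))"
proof -
  have "eval_form N d (g i) x = eval_map N d g x i" using assms by (simp add: eval_map_def)
  also have "\<dots> = (\<Sum>a\<le>N. shift N (\<lambda>b. - c b) (coord_vec a) i * eval_map N d f (shift N c x) a)"
    unfolding eval_shifted by (rule shift_expand[OF assms])
  finally show ?thesis by (simp add: eval_map_def)
qed

text \<open>The chain rule. Both sides arise by differentiating at 0 the restriction to a line in
  direction \<open>coord_vec j\<close>; the two polynomials in one variable are equal because they
  have the same values.\<close>

lemma eval_pderiv_shifted:
  assumes "i \<le> N" "j \<le> N"
  shows "eval_form N (d - 1) (pderiv_form j (g i)) x
    = (\<Sum>a\<le>N. shift N (\<lambda>b. - c b) (coord_vec a) i *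
        (\<Sum>b\<le>N. eval_form N (d - 1) (pderiv_form b (f a)) (shift N c x) * shift N c (coord_vec j) b))"
proof -
  have "line_poly N d (g i) x (coord_vec j) = (\<Sum>a\<le>N. smult (shift N (\<lambda>b. - c b) (coord_vec a) i)
      (line_poly N d (f a) (shift N c x) (shift N c (coord_vec j))))"
    by (rule alg_closed_poly_eqI[OF alg_closed])
      (simp add: poly_line_poly poly_sum eval_component[OF assms(1)] shift_line)
  then have "poly (pderiv (line_poly N d (g i) x (coord_vec j))) 0
    = (\<Sum>a\<le>N. shift N (\<lambda>b. - c b) (coord_vec a) i *
        poly (pderiv (line_poly N d (f a) (shift N c x) (shift N c (coord_vec j)))) 0)"
    by (simp add: pderiv_sum pderiv_smult poly_sum)
  moreover have "poly (pderiv (line_poly N d (g i) x (coord_vec j))) 0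
      = (\<Sum>b\<le>N. if b = j then eval_form N (d - 1) (pderiv_form j (g i)) x else 0)"
  proof -
    have "poly (pderiv (line_poly N d (g i) x (coord_vec j))) 0
        = (\<Sum>b\<le>N. coord_vec j b * eval_form N (d - 1) (pderiv_form b (g i)) x)"
      using poly_pderiv_line_poly[of d N "g i" x "coord_vec j" 0] d by simp
    also have "\<dots> = (\<Sum>b\<le>N. if b = j then eval_form N (d - 1) (pderiv_form j (g i)) x else 0)"
      by (intro sum.cong refl) (auto simp: coord_vec_def)
    finally show ?thesis .
  qed
  ultimately show ?thesis
    using d assms(2) poly_pderiv_line_poly[of d N "f _" "shift N c x" "shift N c (coord_vec j)" 0]
    by (simp add: mult.commute)
qed

lemma jac_shifted: "jac N d g x = jac N d f (shift N c x)"
proof -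
  let ?L = "\<lambda>i a. shift N (\<lambda>b. - c b) (coord_vec a) i" and ?R = "\<lambda>b j. shift N c (coord_vec j) b"
    and ?D = "\<lambda>a b. eval_form N (d - 1) (pderiv_form b (f a)) (shift N c x)"
  have "jac N d g x = detn (Suc N) (\<lambda>i j. \<Sum>a<Suc N. ?L i a * (\<Sum>b<Suc N. ?D a b * ?R b j))"
    unfolding jac_def lessThan_Suc_atMost by (intro detn_cong eval_pderiv_shifted) auto
  also have "\<dots> = detn (Suc N) ?D"
    unfolding detn_mult detn_shift by simp
  finally show ?thesis by (simp add: jac_def)
qed

lemma ram_locus_shifted: "ram_locus N d g = shift N (\<lambda>b. - c b) ` ram_locus N d f"
proof
  show "ram_locus N d g \<subseteq> shift N (\<lambda>b. - c b) ` ram_locus N d f"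
  proof
    fix x assume "x \<in> ram_locus N d g"
    then have "shift N c x \<in> ram_locus N d f"
      using shift_pts[of x N c] by (auto simp: ram_locus_jac jac_shifted)
    then show "x \<in> shift N (\<lambda>b. - c b) ` ram_locus N d f" by (rule rev_image_eqI) simp
  qed
  show "shift N (\<lambda>b. - c b) ` ram_locus N d f \<subseteq> ram_locus N d g"
    using shift_pts by (auto simp: ram_locus_jac jac_shifted)
qed

lemma map_image_shifted:
  "map_image N d g (shift N (\<lambda>b. - c b) ` S) = shift N (\<lambda>b. - c b) ` map_image N d f S"
proof -
  have eq: "(\<lambda>i. a * eval_map N d g (shift N (\<lambda>b. - c b) x) i)
      = shift N (\<lambda>b. - c b) (\<lambda>i. a * eval_map N d f x i)" for a x
    unfolding eval_shifted shift_shift shift_smult ..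
  show ?thesis
  proof
    show "map_image N d g (shift N (\<lambda>b. - c b) ` S) \<subseteq> shift N (\<lambda>b. - c b) ` map_image N d f S"
    proof
      fix y assume "y \<in> map_image N d g (shift N (\<lambda>b. - c b) ` S)"
      then obtain a x where "a \<noteq> 0" "x \<in> S" "y = shift N (\<lambda>b. - c b) (\<lambda>i. a * eval_map N d f x i)"
        unfolding map_image_def eq[symmetric] by blast
      then show "y \<in> shift N (\<lambda>b. - c b) ` map_image N d f S" unfolding map_image_def by blast
    qed
    show "shift N (\<lambda>b. - c b) ` map_image N d f S \<subseteq> map_image N d g (shift N (\<lambda>b. - c b) ` S)"
    proof
      fix y assume "y \<in> shift N (\<lambda>b. - c b) ` map_image N d f S"
      then obtain a x where "a \<noteq> 0" "x \<in> S" "y = shift N (\<lambda>b. - c b) (\<lambda>i. a * eval_map N d f x i)"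
        unfolding map_image_def by blast
      then show "y \<in> map_image N d g (shift N (\<lambda>b. - c b) ` S)"
        unfolding map_image_def eq[symmetric] by blast
    qed
  qed
qed

lemma pcf_shifted:
  assumes "pcf N d f"
  shows "pcf N d g"
proof -
  have "(map_image N d g ^^ n) (ram_locus N d g)
      = shift N (\<lambda>b. - c b) ` (map_image N d f ^^ n) (ram_locus N d f)" for n
    by (induction n) (simp_all add: ram_locus_shifted map_image_shifted)
  then have "range (\<lambda>n. (map_image N d g ^^ n) (ram_locus N d g))
      = image (shift N (\<lambda>b. - c b)) ` range (\<lambda>n. (map_image N d f ^^ n) (ram_locus N d f))"
    by auto
  then show ?thesis using assms unfolding pcf_def by (simp only: finite_imageI)
qed

lemma conjugate_shifted: "conjugate N d f g"
proof -
  let ?A = "\<lambda>b j. shift N c (coord_vec j) b"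
  have mv: "mat_vec N ?A x = shift N c x" if "x \<in> vecs N" for x
  proof
    fix b
    show "mat_vec N ?A x b = shift N c x b"
    proof (cases "b \<le> N")
      case True
      then show ?thesis using shift_expand[OF True, of c x] by (simp add: mat_vec_def)
    next
      case False
      then show ?thesis using that by (simp add: mat_vec_def vecs_def shift_def)
    qed
  qed
  have "mat_vec N ?A (eval_map N d g x) = (\<lambda>i. 1 * eval_map N d f (mat_vec N ?A x) i)"
    if x: "x \<in> vecs N" for x
  proof -
    have "eval_map N d g x \<in> vecs N" by (auto simp: vecs_def eval_map_def)
    then show ?thesis unfolding mv[OF x] by (subst mv) (auto simp: eval_shifted)
  qed
  then show ?thesis unfolding conjugate_def
    by (intro exI[of _ ?A] exI[of _ 1]) (simp add: detn_shift)
qed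

end

lemma monic_poly_top_form:
  assumes f: "monic_poly N d f" and "i < N"
  shows "eval_form N d (f i) (x(N := 0)) = x i ^ d"
  unfolding eval_form_zero_coord using assms
  by (intro eval_form_mono_pow) (auto simp: monic_poly_def mono_pow_def)

text \<open>Replacing x_i by x_i + c_i x_N adds d c_i to the coefficient of x_i^(d-1) x_N, which
  dictates \<open>c\<close>. Components beyond N do not affect the map and are set to 0, so that
  finitely many coefficients determine a representative.\<close>

lemma centered_conjugate:
  fixes f :: "nat \<Rightarrow> 'k::field mpoly"
  assumes ac: "alg_closed TYPE('k)" and "d \<ge> 2" and nz: "of_nat d \<noteq> (0 :: 'k)"
    and f: "monic_poly N d f" "pcf N d f"
  shows "\<exists>g. monic_poly N d g \<and> pcf N d g \<and> conjugate N d f g \<and> (\<forall>i>N. g i = (\<lambda>_. 0)) \<and>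
    (\<forall>i<N. g i ((mono_pow i (d - 1))(N := 1)) = 0)"
proof -
  let ?m = "\<lambda>i. (mono_pow i (d - 1))(N := 1)"
  define c where "c i = - f i (?m i) / of_nat d" for i
  have "form_fun N d (\<lambda>x. shift N (\<lambda>b. - c b) (eval_map N d f (shift N c x)) i)" if "i \<le> N" for i
  proof -
    have "(\<lambda>x. shift N (\<lambda>b. - c b) (eval_map N d f (shift N c x)) i)
        = (\<lambda>x. \<Sum>a\<le>N. shift N (\<lambda>b. - c b) (coord_vec a) i * eval_form N d (f a) (shift N c x))"
      by (intro ext, subst shift_expand[OF that]) (simp add: eval_map_def)
    then show ?thesis by (simp add: form_fun_sum form_fun_smult form_fun_shift)
  qed
  then have "\<forall>i. \<exists>h. i \<le> N \<longrightarrow> homogeneous N d h \<and>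
      (\<forall>x. eval_form N d h x = shift N (\<lambda>b. - c b) (eval_map N d f (shift N c x)) i)"
    using form_fun_homogeneous by blast
  then obtain h where h: "\<And>i. i \<le> N \<Longrightarrow> homogeneous N d (h i)"
      "\<And>i x. i \<le> N \<Longrightarrow> eval_form N d (h i) x = shift N (\<lambda>b. - c b) (eval_map N d f (shift N c x)) i"
    by metis
  define g where "g i = (if i \<le> N then h i else (\<lambda>_. 0))" for i
  interpret shifted_map N d f g c
  proof
    show "eval_map N d g x = shift N (\<lambda>b. - c b) (eval_map N d f (shift N c x))" for x
      using h(2) by (auto simp: eval_map_def g_def shift_def fun_eq_iff)
  qed fact+
  have fN: "eval_form N d (f N) x = x N ^ d" for x
    using f(1) by (intro eval_form_mono_pow) (auto simp: monic_poly_def)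
  have hom_mono: "homogeneous N d (\<lambda>m. if m = mono_pow i d then 1 else 0 :: 'k)" if "i \<le> N" for i
    using mono_pow_mons_deg[OF that] by (simp add: homogeneous_def)
  have eval_g: "eval_form N d (g i) x = eval_form N d (f i) (shift N c x) - c i * x N ^ d" if "i < N" for i x
    using that h(2)[of i x] by (simp add: g_def shift_def eval_map_def fN)
  have eval_gN: "eval_form N d (g N) x = x N ^ d" for x
    using h(2)[of N x] by (simp add: g_def shift_def eval_map_def fN)
  have "g N = (\<lambda>m. if m = mono_pow N d then 1 else 0)"
  proof (rule form_unique[OF ac])
    show "homogeneous N d (g N)" using h(1) by (simp add: g_def)
    show "eval_form N d (g N) x = eval_form N d (\<lambda>m. if m = mono_pow N d then 1 else 0) x" for x
      unfolding eval_gN by (rule eval_form_mono_pow[symmetric]) auto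
  qed (use hom_mono in simp)
  moreover have "(\<lambda>m. if m N = 0 then g i m else 0) = (\<lambda>m. if m = mono_pow i d then 1 else 0)"
    if i: "i < N" for i
  proof (rule form_unique[OF ac])
    show "homogeneous N d (\<lambda>m. if m N = 0 then g i m else 0)"
      using h(1)[of i] i by (auto simp: g_def homogeneous_def)
    show "eval_form N d (\<lambda>m. if m N = 0 then g i m else 0) x
        = eval_form N d (\<lambda>m. if m = mono_pow i d then 1 else 0) x" for x
    proof -
      have "shift N c (x(N := 0)) = x(N := 0)" by (auto simp: shift_def)
      then have "eval_form N d (g i) (x(N := 0)) = x i ^ d"
        unfolding eval_g[OF i] using monic_poly_top_form[OF f(1) i] d by simp
      moreover have "eval_form N d (\<lambda>m. if m = mono_pow i d then 1 else 0) x = x i ^ d"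
        using i by (intro eval_form_mono_pow) auto
      ultimately show ?thesis by (simp add: eval_form_zero_coord)
    qed
  qed (use hom_mono i in simp)
  then have "g i m = (if m = mono_pow i d then 1 else 0)" if "i < N" "m N = 0" for i m
    using that by (metis (mono_tags, lifting))
  ultimately have "monic_poly N d g" unfolding monic_poly_def using h(1) by (simp add: g_def)
  \<comment> \<open>The coefficient of x_i^(d-1) x_N is the derivative along x_N at
    \<open>coord_vec i\<close>, a point fixed by the shift. In the chain rule only d c_i and the old
    coefficient of f_i survive, and they cancel.\<close>
  moreover have "g i (?m i) = 0" if i: "i < N" for i
  proof -
    have sh: "shift N c (coord_vec i) = coord_vec i" using i by (auto simp: shift_def coord_vec_def)
    have D: "eval_form N (d - 1) (pderiv_form b F) (coord_vec i)
        = of_nat (mono_pow i (d - 1) b + 1) * F ((mono_pow i (d - 1))(b := mono_pow i (d - 1) b + 1))"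
      for b and F :: "'k mpoly" using i by (simp add: eval_form_coord_vec pderiv_form_def)
    have Dii: "eval_form N (d - 1) (pderiv_form i (f a)) (coord_vec i) = (if a = i then of_nat d else 0)"
      if "a \<le> N" for a
    proof -
      have "(mono_pow i (d - 1))(i := mono_pow i (d - 1) i + 1) = mono_pow i d"
        using d by (auto simp: mono_pow_def)
      moreover have "f a (mono_pow i d) = (if a = i then 1 else 0)"
        using f(1) that i d unfolding monic_poly_def
        by (cases "a = N") (auto simp: mono_pow_def fun_eq_iff)
      ultimately show ?thesis unfolding D using d by (auto simp: mono_pow_def simp flip: of_nat_Suc)
    qed
    have Dib: "eval_form N (d - 1) (pderiv_form b (f a)) (coord_vec i) = 0"
      if "a = i \<or> a = N" "b < N" "b \<noteq> i" for a b
    proof -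
      let ?k = "(mono_pow i (d - 1))(b := mono_pow i (d - 1) b + 1)"
      have k: "?k b \<noteq> mono_pow i d b" "?k i \<noteq> mono_pow N d i" "?k N = 0"
        using that i d by (auto simp: mono_pow_def)
      have "?k \<noteq> mono_pow i d" "?k \<noteq> mono_pow N d" using k(1,2) by metis+
      then have "f a ?k = 0" using k(3) f(1) that i unfolding monic_poly_def by auto
      then show ?thesis unfolding D by simp
    qed
    have DN: "eval_form N (d - 1) (pderiv_form N F) (coord_vec i) = F (?m i)" for F :: "'k mpoly"
      unfolding D using i by (simp add: mono_pow_def)
    have "f N (?m i) = 0"
    proof -
      have "?m i N \<noteq> mono_pow N d N" using d by (simp add: mono_pow_def)
      then have "?m i \<noteq> mono_pow N d" by metis
      then show ?thesis using f(1) unfolding monic_poly_def by auto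
    qed
    have sum: "(\<Sum>b\<le>N. eval_form N (d - 1) (pderiv_form b (f a)) (coord_vec i) * shift N c (coord_vec N) b)
        = (if a = i then of_nat d * c i else 0) + f a (?m i)" if a: "a = i \<or> a = N" for a
    proof -
      have "(\<Sum>b\<le>N. eval_form N (d - 1) (pderiv_form b (f a)) (coord_vec i) * shift N c (coord_vec N) b)
          = (\<Sum>b\<le>N. (if b = i then (if a = i then of_nat d * c i else 0) else 0)
              + (if b = N then f a (?m i) else 0))"
      proof (rule sum.cong[OF refl])
        fix b assume "b \<in> {..N}"
        then consider "b = i" | "b = N" "b \<noteq> i" | "b < N" "b \<noteq> i" by fastforce
        then show "eval_form N (d - 1) (pderiv_form b (f a)) (coord_vec i) * shift N c (coord_vec N) b
            = (if b = i then (if a = i then of_nat d * c i else 0) else 0) + (if b = N then f a (?m i) else 0)"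
        proof cases
          case 1
          then show ?thesis using Dii[of a] a i by (auto simp: shift_def coord_vec_def)
        next
          case 2
          then show ?thesis using DN[of "f a"] by (auto simp: shift_def coord_vec_def)
        next
          case 3
          then show ?thesis using Dib[OF a] by simp
        qed
      qed
      then show ?thesis using i by (simp add: sum.distrib)
    qed
    have "g i (?m i) = eval_form N (d - 1) (pderiv_form N (g i)) (coord_vec i)" using DN by simp
    also have "\<dots> = (\<Sum>a\<le>N. shift N (\<lambda>b. - c b) (coord_vec a) i *
        (\<Sum>b\<le>N. eval_form N (d - 1) (pderiv_form b (f a)) (coord_vec i) * shift N c (coord_vec N) b))"
      using eval_pderiv_shifted[of i N "coord_vec i"] i unfolding sh by simp
    also have "\<dots> = (\<Sum>a\<le>N. (if a = i then of_nat d * c i + f i (?m i) else 0))"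
    proof (rule sum.cong[OF refl])
      fix a assume "a \<in> {..N}"
      then consider "a = i" | "a = N" "a \<noteq> i" | "a < N" "a \<noteq> i" by fastforce
      then show "shift N (\<lambda>b. - c b) (coord_vec a) i *
          (\<Sum>b\<le>N. eval_form N (d - 1) (pderiv_form b (f a)) (coord_vec i) * shift N c (coord_vec N) b)
          = (if a = i then of_nat d * c i + f i (?m i) else 0)"
      proof cases
        case 1
        then show ?thesis using sum[of i] i by (simp add: shift_def coord_vec_def)
      next
        case 2
        then show ?thesis using sum[of N] \<open>f N (?m i) = 0\<close> by simp
      next
        case 3
        then show ?thesis by (simp add: shift_def coord_vec_def)
      qed
    qed
    also have "\<dots> = 0" using i nz by (simp add: c_def)
    finally show ?thesis .
  qed
  ultimately show ?thesis using pcf_shifted[OF f(2)] conjugate_shifted by (auto simp: g_def)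
qed

section \<open>Countability of the representatives\<close>

theorem theorem1p1:
  fixes N d :: nat
    and K :: "'k::field itself"
  assumes "N \<ge> 1" and "d \<ge> 2"
    and "alg_closed TYPE('k)"
    and "CHAR('k) = 0 \<or> CHAR('k) > d"
  shows "\<exists>S :: (nat \<Rightarrow> 'k mpoly) set.
           countable S \<and> (\<forall>f\<in>S. monic_poly N d f \<and> pcf N d f) \<and>
           (\<forall>f. monic_poly N d f \<and> pcf N d f \<longrightarrow> (\<exists>g\<in>S. conjugate N d f g))"
proof -
  have nz: "of_nat j \<noteq> (0 :: 'k)" if "0 < j" "j \<le> d" for j
    using assms(4) that by (auto simp: of_nat_eq_0_iff_char_dvd dest: dvd_imp_le)
  let ?A = "algebraic_elements :: 'k set"
  define S where "S = {g :: nat \<Rightarrow> 'k mpoly. monic_poly N d g \<and> pcf N d g \<and>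
    (\<forall>i>N. g i = (\<lambda>_. 0)) \<and> (\<forall>i m. g i m \<in> ?A)}"
  have "countable S"
  proof -
    let ?I = "{..N} \<times> mons_deg N d"
    have "finite ?I" using finite_mons_deg by simp
    then obtain xs where xs: "set xs = ?I" using finite_list by blast
    \<comment> \<open>Homogeneity and the vanishing of the components beyond N make \<open>g\<close>
      recoverable from the finite list of its coefficients at \<open>?I\<close>.\<close>
    let ?r = "\<lambda>g. map (\<lambda>(i, m). g i m) xs"
    have "?r ` S \<subseteq> lists ?A" by (auto simp: S_def)
    then have "countable (?r ` S)"
      using countable_lists[OF countable_algebraic_elements] by (rule countable_subset)
    moreover have "inj_on ?r S"
    proof (rule inj_onI)
      fix g g' assume gg: "g \<in> S" "g' \<in> S" "?r g = ?r g'"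
      have "g i m = g' i m" for i m
      proof (cases "(i, m) \<in> ?I")
        case True
        then show ?thesis using gg(3) xs by (auto simp: map_eq_conv)
      next
        case False
        then consider "i > N" | "i \<le> N" "m \<notin> mons_deg N d" by fastforce
        then show ?thesis
        proof cases
          case 1
          then show ?thesis using gg(1,2) by (simp add: S_def)
        next
          case 2
          have "homogeneous N d (g i)" "homogeneous N d (g' i)"
            using gg(1,2) 2(1) by (auto simp: S_def monic_poly_def)
          then show ?thesis using 2(2) by (metis homogeneous_def)
        qed
      qed
      then show "g = g'" by (intro ext)
    qed
    ultimately show ?thesis using countable_image_inj_on[of ?r S] by blast
  qed
  moreover have "\<exists>g\<in>S. conjugate N d f g" if f: "monic_poly N d f" "pcf N d f" for f
  proof -
    obtain g where g: "monic_poly N d g" "pcf N d g" "conjugate N d f g" "\<forall>i>N. g i = (\<lambda>_. 0)"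
        "\<And>i. i < N \<Longrightarrow> g i ((mono_pow i (d - 1))(N := 1)) = 0"
      using centered_conjugate[OF assms(3,2) nz[of d] f] assms(2) by auto
    have "g i m \<in> ?A" for i m
    proof (rule ccontr)
      assume notin: "g i m \<notin> ?A"
      then have i: "i \<le> N" using g(4) zero_algebraic by (metis linorder_not_le)
      obtain V where V: "valuation_ring V" "prime_field \<subseteq> V" "g i m \<notin> V"
        using transcendental_valuation_ring[OF notin] by blast
      interpret valuation_ring V by (rule V(1))
      have "vunit (of_nat j)" if "0 < j" "j \<le> d" for j
        using nz[OF that] inverse_of_nat_prime_field[OF nz[OF that]] V(2) of_nat_mem
        by (auto simp: vunit_def)
      then have "g i m \<in> V" using pcf_coeffs_mem[OF assms(3,2) _ g(1,5,2) i] by blast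
      then show False using V(3) by blast
    qed
    then show ?thesis using g(1-4) by (auto simp: S_def)
  qed
  ultimately show ?thesis by (intro exI[of _ S]) (auto simp: S_def)
qed

end
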